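(* There exists a bounded pseudoconvex domain $\Omega\subseteq\mathbb{C}^n$ with smooth boundary (for some $n\geq 2$) which satisfies Catlin's property (P) and whose Levi core is nontrivial.
   Context: Catlin's property (P): for every $A>0$ there exist a neighborhood $U$ of $b\Omega$ and a function $\lambda\in C^2(U)$ with $0\leq\lambda\leq 1$ such that $\sum_{j,k}\frac{\partial^2\lambda}{\partial z_j\partial\bar z_k}(z)\,\xi_j\bar\xi_k\geq A|\xi|^2$ for all $z\in b\Omega$ and $\xi\in\mathbb{C}^n$. A complex distribution on a smooth manifold $M$ is a subset $\mathcal{D}$ of the complexified tangent bundle $\mathbb{C}TM$ whose fibers $\mathcal{D}_p$ are complex vector subspaces. Its support is $S_{\mathcal{D}}=\{p:\mathcal{D}_p\neq\{0\}\}$. For $S\subseteq M$, $TS\subseteq TM$ has fiber at $p$ the set of $v\in T_pM$ with $df_p(v)=0$ for every smooth real $f$ on $M$ vanishing on $S$, and $\mathbb{C}TS$ is its fiberwise complexification. The derived distribution is $\mathcal{D}'=\mathcal{D}\cap\mathbb{C}TS_{\mathcal{D}}$. By transfinite recursion, $\mathcal{D}^{(0)}=\mathcal{D}$, $\mathcal{D}^{(\alpha+1)}=(\mathcal{D}^{(\alpha)})'$, and $\mathcal{D}^{(\alpha)}=\bigcap_{\beta<\alpha}\mathcal{D}^{(\beta)}$ at limit ordinals. For closed $\mathcal{D}$ there is a countable ordinal $\alpha$ with $(\mathcal{D}^{(\alpha)})'=\mathcal{D}^{(\alpha)}$, and the core $\mathfrak{C}(\mathcal{D})$ is $\mathcal{D}^{(\alpha)}$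 for the minimal such $\alpha$. The Levi-null distribution $\mathcal{N}\subseteq T^{1,0}b\Omega$ is the distribution whose fiber at $p\in b\Omega$ is the kernel of the Levi form of $b\Omega$ at $p$. The Levi core of $\Omega$ is $\mathfrak{C}(\mathcal{N})$; it is nontrivial if its support is nonempty, i.e. if some fiber is nonzero. *)

theory Defs
  imports "HOL-Analysis.Analysis"
begin

section \<open>The space \<open>\<complex>\<^sup>n\<close>\<close>

text \<open>
  The dimension has to be quantified inside the statement, so \<open>\<complex>\<^sup>n\<close> is the set of sequences
  supported in \<open>{..<n}\<close>. The type \<^typ>\<open>nat \<Rightarrow> complex\<close> carries the product topology, whose
  restriction to \<open>Cn n\<close> is the Euclidean topology. Since \<open>Cn n\<close> has empty interior in the
  ambient space, open sets and boundaries are always taken relative to \<open>Cn n\<close>; the metric of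
  \<^typ>\<open>nat \<Rightarrow> complex\<close> is not Euclidean (it is bounded) and is never used.
\<close>

type_synonym cvec = "nat \<Rightarrow> complex"

definition Cn :: "nat \<Rightarrow> cvec set" where
  "Cn n = {z. \<forall>j\<ge>n. z j = 0}"

definition cnorm :: "nat \<Rightarrow> cvec \<Rightarrow> real" where
  "cnorm n z = L2_set (\<lambda>j. cmod (z j)) {..<n}"

definition open_Cn :: "nat \<Rightarrow> cvec set \<Rightarrow> bool" where
  "open_Cn n U \<longleftrightarrow> openin (top_of_set (Cn n)) U"

definition bdry :: "nat \<Rightarrow> cvec set \<Rightarrow> cvec set" where
  "bdry n \<Omega> = top_of_set (Cn n) frontier_of \<Omega>"

definition bounded_domain :: "nat \<Rightarrow> cvec set \<Rightarrow> bool" where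
  "bounded_domain n \<Omega> \<longleftrightarrow>
     open_Cn n \<Omega> \<and> connected \<Omega> \<and> \<Omega> \<noteq> {} \<and> (\<exists>R. \<forall>z\<in>\<Omega>. cnorm n z \<le> R)"


section \<open>Differentiation\<close>

text \<open>
  Real tangent vectors of \<open>\<complex>\<^sup>n = \<real>\<^sup>2\<^sup>n\<close> are elements \<open>v\<close> of \<open>Cn n\<close>; for \<open>f\<close> of class \<open>C\<^sup>1\<close> near \<open>z\<close>,
  \<open>dir_deriv f z v\<close> is \<open>df\<^sub>z(v)\<close>.
\<close>

definition shift :: "cvec \<Rightarrow> cvec \<Rightarrow> real \<Rightarrow> cvec" where
  "shift z v t = (\<lambda>j. z j + of_real t * v j)"

definition dir_deriv :: "(cvec \<Rightarrow> 'b::real_normed_vector) \<Rightarrow> cvec \<Rightarrow> cvec \<Rightarrow> 'b" where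
  "dir_deriv f z v = vector_derivative (\<lambda>t. f (shift z v t)) (at 0)"

text \<open>\<open>coord j 1\<close> is \<open>\<partial>/\<partial>x\<^sub>j\<close> and \<open>coord j \<i>\<close> is \<open>\<partial>/\<partial>y\<^sub>j\<close>.\<close>

definition coord :: "nat \<Rightarrow> complex \<Rightarrow> cvec" where
  "coord j c = (\<lambda>i. if i = j then c else 0)"

text \<open>\<open>C_k n k U f\<close>: all real partial derivatives of \<open>f\<close> of order at most \<open>k\<close> exist and are
  continuous on \<open>U\<close>, which is meant to be open in \<open>Cn n\<close>.\<close>

primrec C_k :: "nat \<Rightarrow> nat \<Rightarrow> cvec set \<Rightarrow> (cvec \<Rightarrow> real) \<Rightarrow> bool" where
  "C_k n 0 U f \<longleftrightarrow> continuous_on U f"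
| "C_k n (Suc k) U f \<longleftrightarrow> continuous_on U f \<and>
     (\<forall>j<n. \<forall>c\<in>{1, \<i>}.
        (\<forall>z\<in>U. (\<lambda>t. f (shift z (coord j c) t)) differentiable (at 0)) \<and>
        C_k n k U (\<lambda>z. dir_deriv f z (coord j c)))"

definition C_infinity :: "nat \<Rightarrow> cvec set \<Rightarrow> (cvec \<Rightarrow> real) \<Rightarrow> bool" where
  "C_infinity n U f \<longleftrightarrow> (\<forall>k. C_k n k U f)"

definition d_z :: "nat \<Rightarrow> (cvec \<Rightarrow> complex) \<Rightarrow> cvec \<Rightarrow> complex" where
  "d_z j f z = (dir_deriv f z (coord j 1) - \<i> * dir_deriv f z (coord j \<i>)) / 2"

definition d_zbar :: "nat \<Rightarrow> (cvec \<Rightarrow> complex) \<Rightarrow> cvec \<Rightarrow> complex" where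
  "d_zbar j f z = (dir_deriv f z (coord j 1) + \<i> * dir_deriv f z (coord j \<i>)) / 2"

definition complex_hessian ::
    "nat \<Rightarrow> (cvec \<Rightarrow> real) \<Rightarrow> cvec \<Rightarrow> cvec \<Rightarrow> cvec \<Rightarrow> complex" where
  "complex_hessian n f z \<xi> \<eta> =
     (\<Sum>j<n. \<Sum>k<n. d_z j (d_zbar k (\<lambda>w. of_real (f w))) z * \<xi> j * cnj (\<eta> k))"


section \<open>Property (P)\<close>

text \<open>The Hessian at \<open>(\<xi>, \<xi>)\<close> is real because \<open>\<lambda>\<close> is of class \<open>C\<^sup>2\<close>; \<^const>\<open>Re\<close> only adjusts the
  type.\<close>

definition property_P :: "nat \<Rightarrow> cvec set \<Rightarrow> bool" where
  "property_P n \<Omega> \<longleftrightarrow>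
     (\<forall>A>0. \<exists>U lam. open_Cn n U \<and> bdry n \<Omega> \<subseteq> U \<and> C_k n 2 U lam \<and>
        (\<forall>z\<in>U. 0 \<le> lam z \<and> lam z \<le> 1) \<and>
        (\<forall>z\<in>bdry n \<Omega>. \<forall>\<xi>\<in>Cn n.
           Re (complex_hessian n lam z \<xi> \<xi>) \<ge> A * (cnorm n \<xi>)\<^sup>2))"


section \<open>Tangent bundles and complex distributions\<close>

text \<open>
  In this section \<open>M\<close> is a closed embedded submanifold of \<open>\<complex>\<^sup>n\<close> (below, the boundary of a domain).
  The smooth functions on \<open>M\<close> are then exactly the restrictions to \<open>M\<close> of functions that are smooth
  on some neighbourhood of \<open>M\<close>, and \<open>T\<^sub>pM\<close> is the common kernel of the differentials of those that
  vanish on \<open>M\<close>.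
\<close>

definition smooth_near :: "nat \<Rightarrow> cvec set \<Rightarrow> (cvec \<Rightarrow> real) \<Rightarrow> bool" where
  "smooth_near n M f \<longleftrightarrow> (\<exists>U. open_Cn n U \<and> M \<subseteq> U \<and> C_infinity n U f)"

definition tangent_bundle :: "nat \<Rightarrow> cvec set \<Rightarrow> (cvec \<times> cvec) set" where
  "tangent_bundle n M = {(p, v). p \<in> M \<and> v \<in> Cn n \<and>
     (\<forall>f. smooth_near n M f \<and> (\<forall>x\<in>M. f x = 0) \<longrightarrow> dir_deriv f p v = 0)}"

text \<open>The subset \<open>TS\<close> of \<open>TM\<close>, for an arbitrary subset \<open>S\<close> of \<open>M\<close>.\<close>

definition tangent_of_subset :: "nat \<Rightarrow> cvec set \<Rightarrow> cvec set \<Rightarrow> (cvec \<times> cvec) set" where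
  "tangent_of_subset n M S = {(p, v). (p, v) \<in> tangent_bundle n M \<and>
     (\<forall>f. smooth_near n M f \<and> (\<forall>x\<in>S. f x = 0) \<longrightarrow> dir_deriv f p v = 0)}"

text \<open>
  The element \<open>u + \<i>w\<close> of the complexification of a real tangent space is represented by the pair
  \<open>(u, w)\<close> of real tangent vectors. This \<open>\<i>\<close> is unrelated to the multiplication by \<open>\<i>\<close>
  on \<^typ>\<open>cvec\<close>.
\<close>

type_synonym ctangent = "cvec \<times> (cvec \<times> cvec)"

definition complexify :: "(cvec \<times> cvec) set \<Rightarrow> ctangent set" where
  "complexify T = {(p, u, w). (p, u) \<in> T \<and> (p, w) \<in> T}"

definition fiber :: "ctangent set \<Rightarrow> cvec \<Rightarrow> (cvec \<times> cvec) set" where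
  "fiber D p = {X. (p, X) \<in> D}"

text \<open>The fibers of a distribution are complex subspaces, so the condition says
  that the fiber is not \<open>{0}\<close>.\<close>

definition dsupport :: "cvec set \<Rightarrow> ctangent set \<Rightarrow> cvec set" where
  "dsupport M D = {p \<in> M. \<not> fiber D p \<subseteq> {(\<lambda>_. 0, \<lambda>_. 0)}}"

definition derived_distr :: "nat \<Rightarrow> cvec set \<Rightarrow> ctangent set \<Rightarrow> ctangent set" where
  "derived_distr n M D = D \<inter> complexify (tangent_of_subset n M (dsupport M D))"


section \<open>Transfinite iteration and the core\<close>

text \<open>The elements of \<open>Field omega1\<close> serve as the countable ordinals: as the cardinal successor of
  \<open>\<aleph>\<^sub>0\<close>, \<open>omega1\<close> is a well-order of type \<open>\<omega>\<^sub>1\<close>.\<close>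

definition omega1 :: "nat set rel" where
  "omega1 = cardSuc natLeq"

definition is_succ_of :: "nat set \<Rightarrow> nat set \<Rightarrow> bool" where
  "is_succ_of \<alpha> \<beta> \<longleftrightarrow>
     \<beta> \<in> underS omega1 \<alpha> \<and> (\<forall>\<gamma>\<in>underS omega1 \<alpha>. (\<gamma>, \<beta>) \<in> omega1)"

definition iter_distr :: "nat \<Rightarrow> cvec set \<Rightarrow> ctangent set \<Rightarrow> nat set \<Rightarrow> ctangent set" where
  "iter_distr n M D = wo_rel.worec omega1 (\<lambda>F \<alpha>.
     if underS omega1 \<alpha> = {} then D
     else if \<exists>\<beta>. is_succ_of \<alpha> \<beta> then derived_distr n M (F (THE \<beta>. is_succ_of \<alpha> \<beta>))
     else (\<Inter>\<beta>\<in>underS omega1 \<alpha>. F \<beta>))"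

lemma omega1_wo_rel: "wo_rel omega1"
  unfolding wo_rel_def omega1_def
  using cardSuc_Card_order[OF natLeq_Card_order] by (simp add: card_order_on_well_order_on)

lemma is_succ_of_unique:
  assumes "is_succ_of \<alpha> \<beta>" "is_succ_of \<alpha> \<gamma>"
  shows "\<gamma> = \<beta>"
  using assms wo_rel.ANTISYM[OF omega1_wo_rel]
  unfolding is_succ_of_def antisym_def by blast

lemma iter_distr_unfold:
  "iter_distr n M D \<alpha> =
     (if underS omega1 \<alpha> = {} then D
      else if \<exists>\<beta>. is_succ_of \<alpha> \<beta>
        then derived_distr n M (iter_distr n M D (THE \<beta>. is_succ_of \<alpha> \<beta>))
      else (\<Inter>\<beta>\<in>underS omega1 \<alpha>. iter_distr n M D \<beta>))"
proof -
  define H where "H = (\<lambda>F \<alpha>.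
     if underS omega1 \<alpha> = {} then D
     else if \<exists>\<beta>. is_succ_of \<alpha> \<beta> then derived_distr n M (F (THE \<beta>. is_succ_of \<alpha> \<beta>))
     else (\<Inter>\<beta>\<in>underS omega1 \<alpha>. F \<beta>))"
  have the: "(THE \<beta>. is_succ_of \<alpha> \<beta>) \<in> underS omega1 \<alpha>" if "is_succ_of \<alpha> \<beta>" for \<alpha> \<beta>
  proof -
    have "(THE \<beta>. is_succ_of \<alpha> \<beta>) = \<beta>"
      using that is_succ_of_unique by (intro the_equality) auto
    then show ?thesis using that unfolding is_succ_of_def by simp
  qed
  have "H f x = H g x" if "\<forall>y\<in>underS omega1 x. f y = g y" for f g x
    using that the[of x] unfolding H_def by auto
  then have "wo_rel.adm_wo omega1 H"
    unfolding wo_rel.adm_wo_def[OF omega1_wo_rel] by blast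
  from wo_rel.worec_fixpoint[OF omega1_wo_rel this]
  have "iter_distr n M D = H (iter_distr n M D)"
    unfolding iter_distr_def H_def .
  then show ?thesis by (simp add: H_def fun_eq_iff)
qed

lemma iter_distr_zero:
  assumes "underS omega1 \<alpha> = {}"
  shows "iter_distr n M D \<alpha> = D"
  using assms iter_distr_unfold by simp

lemma iter_distr_succ:
  assumes "is_succ_of \<alpha> \<beta>"
  shows "iter_distr n M D \<alpha> = derived_distr n M (iter_distr n M D \<beta>)"
proof -
  have "(THE \<beta>. is_succ_of \<alpha> \<beta>) = \<beta>"
    using assms is_succ_of_unique by (intro the_equality) auto
  moreover have "underS omega1 \<alpha> \<noteq> {}"
    using assms unfolding is_succ_of_def by auto
  ultimately show ?thesis
    using assms iter_distr_unfold[of n M D \<alpha>] by auto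
qed

lemma iter_distr_limit:
  assumes "underS omega1 \<alpha> \<noteq> {}" "\<nexists>\<beta>. is_succ_of \<alpha> \<beta>"
  shows "iter_distr n M D \<alpha> = (\<Inter>\<beta>\<in>underS omega1 \<alpha>. iter_distr n M D \<beta>)"
  by (subst iter_distr_unfold) (simp only: assms if_False)

definition core :: "nat \<Rightarrow> cvec set \<Rightarrow> ctangent set \<Rightarrow> ctangent set" where
  "core n M D = iter_distr n M D (wo_rel.minim omega1
     {\<alpha> \<in> Field omega1. derived_distr n M (iter_distr n M D \<alpha>) = iter_distr n M D \<alpha>})"


section \<open>Smooth boundaries, the Levi form and the Levi core\<close>

definition defining_function ::
    "nat \<Rightarrow> cvec set \<Rightarrow> cvec set \<Rightarrow> (cvec \<Rightarrow> real) \<Rightarrow> bool" where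
  "defining_function n \<Omega> U \<rho> \<longleftrightarrow>
     open_Cn n U \<and> bdry n \<Omega> \<subseteq> U \<and> C_infinity n U \<rho> \<and>
     \<Omega> \<inter> U = {z \<in> U. \<rho> z < 0} \<and> bdry n \<Omega> = {z \<in> U. \<rho> z = 0} \<and>
     (\<forall>p\<in>bdry n \<Omega>. \<exists>v\<in>Cn n. dir_deriv \<rho> p v \<noteq> 0)"

definition smooth_boundary :: "nat \<Rightarrow> cvec set \<Rightarrow> bool" where
  "smooth_boundary n \<Omega> \<longleftrightarrow> (\<exists>U \<rho>. defining_function n \<Omega> U \<rho>)"

text \<open>
  The vector \<open>\<Sum>\<^sub>j \<xi>\<^sub>j \<partial>/\<partial>z\<^sub>j\<close> as an element \<open>u + \<i>w\<close> of the complexified tangent space: from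
  \<open>\<partial>/\<partial>z\<^sub>j = (\<partial>/\<partial>x\<^sub>j - \<i> \<partial>/\<partial>y\<^sub>j)/2\<close> one gets \<open>u = \<xi>/2\<close> and \<open>w = -Ju\<close>, where \<open>J\<close> is the
  complex structure of \<open>\<complex>\<^sup>n\<close>.
\<close>

definition holo_vector :: "cvec \<Rightarrow> cvec \<times> cvec" where
  "holo_vector \<xi> = (\<lambda>j. \<xi> j / 2, \<lambda>j. - \<i> * \<xi> j / 2)"

text \<open>Coefficient vectors of the fiber of \<open>T\<^sup>1\<^sup>,\<^sup>0M = T\<^sup>1\<^sup>,\<^sup>0\<complex>\<^sup>n \<inter> \<complex>TM\<close> at \<open>p\<close>.\<close>

definition T10 :: "nat \<Rightarrow> cvec set \<Rightarrow> cvec \<Rightarrow> cvec set" where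
  "T10 n M p = {\<xi> \<in> Cn n. (p, holo_vector \<xi>) \<in> complexify (tangent_bundle n M)}"

text \<open>
  On \<open>T\<^sup>1\<^sup>,\<^sup>0\<close> of the boundary, the Levi form is the complex Hessian of a defining function.
  Changing the defining function multiplies it by a positive function, so neither
  semidefiniteness nor the kernel depends on the choice.
\<close>

definition pseudoconvex :: "nat \<Rightarrow> cvec set \<Rightarrow> bool" where
  "pseudoconvex n \<Omega> \<longleftrightarrow>
     (\<exists>U \<rho>. defining_function n \<Omega> U \<rho> \<and>
        (\<forall>p\<in>bdry n \<Omega>. \<forall>\<xi>\<in>T10 n (bdry n \<Omega>) p. Re (complex_hessian n \<rho> p \<xi> \<xi>) \<ge> 0))"

definition levi_null :: "nat \<Rightarrow> cvec set \<Rightarrow> ctangent set" where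
  "levi_null n \<Omega> = {(p, X). p \<in> bdry n \<Omega> \<and>
     (\<exists>\<xi>\<in>T10 n (bdry n \<Omega>) p. X = holo_vector \<xi> \<and>
        (\<exists>U \<rho>. defining_function n \<Omega> U \<rho> \<and>
           (\<forall>\<eta>\<in>T10 n (bdry n \<Omega>) p. complex_hessian n \<rho> p \<xi> \<eta> = 0)))}"

definition levi_core :: "nat \<Rightarrow> cvec set \<Rightarrow> ctangent set" where
  "levi_core n \<Omega> = core n (bdry n \<Omega>) (levi_null n \<Omega>)"

definition nontrivial_levi_core :: "nat \<Rightarrow> cvec set \<Rightarrow> bool" where
  "nontrivial_levi_core n \<Omega> \<longleftrightarrow> dsupport (bdry n \<Omega>) (levi_core n \<Omega>) \<noteq> {}"

end

theory Submission
  imports Defs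
begin

text \<open>
  The domain is a Hartogs domain \<open>\<Omega> = {\<rho> < 0}\<close> in \<open>\<complex>\<^sup>2\<close>, in coordinates \<open>(x + \<i> y, w)\<close>, with
    \<open>\<rho> = \<bar>w\<bar>\<^sup>2 exp(h(x)) + k(x) + k(y) - 1\<close>.
  Here \<open>h'' = f\<close>, where \<open>f \<ge> 0\<close> is a smooth function that vanishes on a Cantor set \<open>K\<close>, and \<open>k\<close> is a
  smooth convex function that vanishes on an interval around \<open>K\<close> and closes up the domain
  (\<open>cantor_bump\<close>, \<open>cantor\<close> and \<open>cap\<close> below). The complex Hessian of \<open>\<rho>\<close> is
    \<open>exp(h) \<bar>\<xi>\<^sub>1 + w h'/2 \<xi>\<^sub>0\<bar>\<^sup>2 + (\<bar>w\<bar>\<^sup>2 exp(h) f(x) + k''(x) + k''(y)) / 4 \<bar>\<xi>\<^sub>0\<bar>\<^sup>2 \<ge> 0\<close>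
  (\<open>weighted_hessian\<close>), so \<open>\<Omega>\<close> is pseudoconvex.

  The Levi core is nontrivial. Over the set \<open>S\<close> where \<open>x \<in> K\<close>, \<open>\<bar>y\<bar> < 1\<close> and \<open>\<bar>w\<bar>\<^sup>2 exp(h(x)) = 1\<close>, the
  second square has coefficient \<open>0\<close>, so that \<open>(1, - w h'/2)\<close> spans the kernel of the Levi form. This
  direction is tangent to the sheet
    \<open>(x, y) \<mapsto> (x + \<i> y, w exp(- (h(x) - h(x\<^sub>0)) / 2 - \<i> (y - y\<^sub>0) h'(x\<^sub>0) / 2))\<close>,
  whose points over \<open>K \<times> (-1, 1)\<close> lie in \<open>S\<close>. A smooth function that vanishes on \<open>S\<close> vanishes there, so
  its derivative along the sheet is \<open>0\<close> in the direction \<open>y\<close>, and also in the direction \<open>x\<close> because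
  \<open>K\<close> has no isolated point (\<open>dir_deriv_null_vector\<close>). Therefore the null directions over \<open>S\<close>
  survive every derivation, and by transfinite induction they lie in the core (\<open>subset_core\<close>).

  Property (P) holds because \<open>K\<close> is so thin that there are uniformly bounded functions of \<open>x\<close> with
  arbitrarily large second derivative on it: \<open>K\<close> is defined by \<open>cos(3\<^sup>m x) \<ge> -1/2\<close> for all \<open>m\<close>, and
  there is a trigonometric polynomial \<open>g\<close> with \<open>g'' \<ge> 1/80\<close> wherever \<open>cos \<ge> -1/2\<close>, so that
  \<open>g(3\<^sup>m x)\<close> has second derivative at least \<open>9\<^sup>m / 80\<close> on \<open>K\<close> (\<open>ripple\<close>). Away from \<open>K\<close> this
  second derivative may be negative, but there the multiple \<open>M \<rho>\<close> compensates for it when \<open>M\<close> is large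
  (\<open>bump_dominates_ripple\<close>). As \<open>\<rho> = 0\<close> on the boundary, \<open>M \<rho>\<close> is as small as desired on a suitable
  neighbourhood, and \<open>M \<rho> + g(3\<^sup>m x) + 1/2\<close> has the required properties (\<open>property_P_Omega\<close>).
\<close>

section \<open>Smooth functions of one real variable\<close>

coinductive smooth :: "(real \<Rightarrow> real) \<Rightarrow> bool" where
  smoothI: "(\<And>x. (f has_real_derivative f' x) (at x)) \<Longrightarrow> smooth f' \<Longrightarrow> smooth f"

lemma smoothE:
  assumes "smooth f"
  obtains f' where "\<And>x. (f has_real_derivative f' x) (at x)" "smooth f'"
  using smooth.cases[OF assms] by metis

text \<open>
  Coinduction alone does not show that products are smooth, since the derivative of a product
  is a sum of products. The closure of a set of generators under sums and products absorbs this.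
\<close>

inductive_set algebra_of :: "(real \<Rightarrow> real) set \<Rightarrow> (real \<Rightarrow> real) set" for S where
  gen: "f \<in> S \<Longrightarrow> f \<in> algebra_of S"
| add: "f \<in> algebra_of S \<Longrightarrow> g \<in> algebra_of S \<Longrightarrow> (\<lambda>x. f x + g x) \<in> algebra_of S"
| mult: "f \<in> algebra_of S \<Longrightarrow> g \<in> algebra_of S \<Longrightarrow> (\<lambda>x. f x * g x) \<in> algebra_of S"

lemma smooth_algebra_of:
  assumes S: "\<And>f. f \<in> S \<Longrightarrow> \<exists>f'\<in>algebra_of S. \<forall>x. (f has_real_derivative f' x) (at x)"
    and "f \<in> algebra_of S"
  shows "smooth f"
proof -
  have step: "\<exists>f'\<in>algebra_of S. \<forall>x. (f has_real_derivative f' x) (at x)" if "f \<in> algebra_of S" for f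
    using that
  proof induction
    case (gen f)
    then show ?case by (rule S)
  next
    case (add f g)
    then obtain f' g' where "f' \<in> algebra_of S" "\<forall>x. (f has_real_derivative f' x) (at x)"
      "g' \<in> algebra_of S" "\<forall>x. (g has_real_derivative g' x) (at x)" by blast
    then show ?case
      by (intro bexI[of _ "\<lambda>x. f' x + g' x"])
        (auto intro!: derivative_eq_intros algebra_of.add)
  next
    case (mult f g)
    then obtain f' g' where "f' \<in> algebra_of S" "\<forall>x. (f has_real_derivative f' x) (at x)"
      "g' \<in> algebra_of S" "\<forall>x. (g has_real_derivative g' x) (at x)" by blast
    then show ?case using mult.hyps
      by (intro bexI[of _ "\<lambda>x. f' x * g x + g' x * f x"])
        (auto intro!: derivative_eq_intros algebra_of.add algebra_of.mult)
  qed
  show ?thesis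
    using assms(2)
  proof (coinduction arbitrary: f)
    case smooth
    then obtain f' where "f' \<in> algebra_of S" "\<forall>x. (f has_real_derivative f' x) (at x)"
      using step by blast
    then show ?case by (rule_tac exI[of _ f], rule_tac exI[of _ f']) (auto simp: step)
  qed
qed

lemma smooth_algebra_of_smooth: "f \<in> algebra_of {f. smooth f} \<Longrightarrow> smooth f"
proof (erule smooth_algebra_of[rotated])
  fix f :: "real \<Rightarrow> real" assume "f \<in> {f. smooth f}"
  then obtain f' where "\<And>x. (f has_real_derivative f' x) (at x)" "smooth f'"
    using smoothE by blast
  then show "\<exists>f'\<in>algebra_of {f. smooth f}. \<forall>x. (f has_real_derivative f' x) (at x)"
    by (intro bexI[of _ f']) (auto intro: algebra_of.gen)
qed

lemma smooth_add: "smooth f \<Longrightarrow> smooth g \<Longrightarrow> smooth (\<lambda>x. f x + g x)"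
  by (rule smooth_algebra_of_smooth) (auto intro: algebra_of.intros)

lemma smooth_mult: "smooth f \<Longrightarrow> smooth g \<Longrightarrow> smooth (\<lambda>x. f x * g x)"
  by (rule smooth_algebra_of_smooth) (auto intro: algebra_of.intros)

lemma smooth_const: "smooth (\<lambda>_. c)"
  by (coinduction arbitrary: c) (auto intro: exI[of _ "\<lambda>_. 0"])

lemma smooth_id: "smooth (\<lambda>x. x)"
  by (rule smoothI[OF _ smooth_const[of 1]]) auto

lemma smooth_trig: "smooth (\<lambda>x. a * cos x + b * sin x)"
proof (coinduction arbitrary: a b)
  case smooth
  have "((\<lambda>x. a * cos x + b * sin x) has_real_derivative b * cos x + - a * sin x) (at x)" for x
    by (auto intro!: derivative_eq_intros)
  then show ?case by (metis (no_types, lifting))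
qed

lemma smooth_cos: "smooth cos"
  using smooth_trig[of 1 0] by simp

lemma smooth_exp: "smooth exp"
  by (coinduction) (auto intro!: exI[of _ exp] derivative_eq_intros)

text \<open>
  The compositions \<open>v \<circ> g\<close> with smooth \<open>v\<close> are not closed under differentiation, but together with all
  smooth functions they generate an algebra that is, because \<open>(v \<circ> g)' = (v' \<circ> g) g'\<close>.
\<close>

lemma smooth_compose:
  assumes "smooth u" "smooth g"
  shows "smooth (\<lambda>x. u (g x))"
proof -
  let ?S = "{f. smooth f} \<union> {\<lambda>x. u (g x) | u. smooth u}"
  obtain g' where g': "\<And>x. (g has_real_derivative g' x) (at x)" "smooth g'"
    using smoothE[OF \<open>smooth g\<close>] by metis
  have "\<exists>f'\<in>algebra_of ?S. \<forall>x. (f has_real_derivative f' x) (at x)" if f: "f \<in> ?S" for f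
  proof (cases "smooth f")
    case True
    then obtain f' where "\<And>x. (f has_real_derivative f' x) (at x)" "smooth f'"
      using smoothE by blast
    then show ?thesis by (intro bexI[of _ f']) (auto intro: algebra_of.gen)
  next
    case False
    then obtain v where v: "smooth v" "f = (\<lambda>x. v (g x))" using f by auto
    obtain v' where v': "\<And>x. (v has_real_derivative v' x) (at x)" "smooth v'"
      using smoothE[OF v(1)] by metis
    have "(\<lambda>x. v' (g x)) \<in> algebra_of ?S" "g' \<in> algebra_of ?S"
      using v' g' by (auto intro!: algebra_of.gen)
    then show ?thesis
      using v v' g'
      by (intro bexI[of _ "\<lambda>x. v' (g x) * g' x"])
        (auto intro: DERIV_chain2 algebra_of.mult)
  qed
  then show ?thesis
    by (rule smooth_algebra_of) (use assms in \<open>auto intro: algebra_of.gen\<close>)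
qed

lemma smooth_cos_comp: "smooth g \<Longrightarrow> smooth (\<lambda>x. cos (g x))"
  by (rule smooth_compose[OF smooth_cos])

lemmas smooth_intros = smooth_add smooth_mult smooth_const smooth_id smooth_cos_comp
  smooth_compose[OF smooth_exp]

lemma smooth_continuous: "smooth f \<Longrightarrow> continuous_on A f"
  by (meson DERIV_continuous_on has_field_derivative_at_within smoothE)

lemma smooth_antiderivative:
  assumes "smooth f"
  obtains F where "smooth F" "\<And>x. (F has_real_derivative f x) (at x)"
proof -
  have "continuous_on UNIV f" using assms by (rule smooth_continuous)
  then have "\<exists>F. \<forall>x::real. -\<infinity> < ereal x \<longrightarrow> ereal x < \<infinity> \<longrightarrow> (F has_vector_derivative f x) (at x)"
    by (intro einterval_antiderivative) (auto simp: continuous_on_eq_continuous_at)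
  then obtain F where "\<And>x. (F has_real_derivative f x) (at x)"
    by (auto simp: has_real_derivative_iff_has_vector_derivative)
  with assms show ?thesis by (metis smoothI that)
qed

section \<open>The flat functions \<open>s\<^sup>-\<^sup>n exp(-1/s)\<close>\<close>

definition flat :: "nat \<Rightarrow> real \<Rightarrow> real" where
  "flat n s = (if s > 0 then (1/s) ^ n * exp (- (1/s)) else 0)"

lemma flat_div_tendsto: "((\<lambda>s. flat n s / s) \<longlongrightarrow> 0) (at 0)"
proof (rule filterlim_split_at)
  show "((\<lambda>s. flat n s / s) \<longlongrightarrow> 0) (at_left 0)"
    by (rule tendsto_eventually) (auto simp: eventually_at_filter flat_def)
  have "((\<lambda>x::real. x ^ Suc n / exp x) \<longlongrightarrow> 0) at_top"
    by (rule tendsto_power_div_exp_0)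
  then have "((\<lambda>s. inverse s ^ Suc n / exp (inverse s)) \<longlongrightarrow> (0::real)) (at_right 0)"
    by (rule filterlim_compose[OF _ filterlim_inverse_at_top_right])
  then show "((\<lambda>s. flat n s / s) \<longlongrightarrow> 0) (at_right 0)"
    by (rule tendsto_cong[THEN iffD1, rotated])
      (auto simp: eventually_at_filter flat_def exp_minus field_simps)
qed

text \<open>
  The family is indexed by the exponent so that it is closed under differentiation up to linear
  combinations; this gives smoothness of all members at once.
\<close>

lemma flat_derivative:
  "(flat n has_real_derivative flat (n + 2) s - n * flat (Suc n) s) (at s)"
proof -
  consider "s > 0" | "s < 0" | "s = 0" by linarith
  then show ?thesis
  proof cases
    case 1
    have *: "((\<lambda>s. (1/s) ^ n * exp (- (1/s))) has_real_derivative
        flat (n + 2) s - n * flat (Suc n) s) (at s)"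
    proof (cases n)
      case 0
      then show ?thesis using 1
        by (auto intro!: derivative_eq_intros simp: flat_def power2_eq_square)
    next
      case (Suc m)
      have d: "((\<lambda>s. 1/s) has_real_derivative - (1/s^2)) (at s)"
        using 1 by (auto intro!: derivative_eq_intros simp: power2_eq_square)
      show ?thesis
        unfolding Suc
        by (rule DERIV_cong[OF DERIV_mult[OF DERIV_power_Suc[OF d] DERIV_fun_exp[OF DERIV_minus[OF d]]]])
          (use 1 in \<open>simp add: flat_def power2_eq_square field_simps\<close>)
    qed
    show ?thesis
      by (rule has_field_derivative_transform_within[OF *, of s]) (use 1 in \<open>auto simp: flat_def dist_real_def\<close>)
  next
    case 2
    show ?thesis
      by (rule has_field_derivative_transform_within[of "\<lambda>_. 0" _ _ _ "-s"])
        (use 2 in \<open>auto simp: flat_def dist_real_def\<close>)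
  next
    case 3
    then show ?thesis
      using flat_div_tendsto[of n] by (auto simp: has_field_derivative_iff flat_def)
  qed
qed

lemma smooth_flat: "smooth (flat n)"
proof (rule smooth_algebra_of[where S = "range flat \<union> range (\<lambda>c _. c)"])
  let ?A = "algebra_of (range flat \<union> range (\<lambda>c _. c))"
  have fl: "flat m \<in> ?A" and c: "(\<lambda>_. c) \<in> ?A" for m c by (auto intro: algebra_of.gen)
  fix f :: "real \<Rightarrow> real" assume "f \<in> range flat \<union> range (\<lambda>c _. c)"
  then consider m where "f = flat m" | c where "f = (\<lambda>_. c)" by auto
  then show "\<exists>f'\<in>?A. \<forall>x. (f has_real_derivative f' x) (at x)"
  proof cases
    case 1
    have "(\<lambda>s. flat (m + 2) s + (- real m) * flat (Suc m) s) \<in> ?A"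
      by (intro algebra_of.add algebra_of.mult fl c)
    moreover have "\<forall>x. (f has_real_derivative (flat (m + 2) x + (- real m) * flat (Suc m) x)) (at x)"
      using flat_derivative[of m] 1 by simp
    ultimately show ?thesis by (intro bexI)
  next
    case 2
    then show ?thesis using c[of 0] by (intro bexI[of _ "\<lambda>_. 0"]) auto
  qed
qed (auto intro: algebra_of.gen)

lemma flat_nonneg: "flat n s \<ge> 0" by (simp add: flat_def)
lemma flat_pos: "s > 0 \<Longrightarrow> flat n s > 0" by (simp add: flat_def)
lemma flat_nonpos_arg: "s \<le> 0 \<Longrightarrow> flat n s = 0" by (simp add: flat_def)
lemma flat_0_mono: "s \<le> t \<Longrightarrow> flat 0 s \<le> flat 0 t"
  by (auto simp: flat_def divide_simps)

section \<open>A Cantor set and a smooth function vanishing on it\<close>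

text \<open>
  The condition \<open>cos(3\<^sup>n x) \<ge> -1/2\<close> for all \<open>n\<close> says that in base 3 no digit of \<open>x / (2 \<pi>)\<close> has
  to be 1. So \<open>cantor\<close> is the ternary Cantor set, scaled to \<open>[0, 2 \<pi>]\<close> in order that no factor
  \<open>2 \<pi>\<close> occurs in the series. The factorials make all derivatives of the series converge uniformly.
\<close>

definition cantor_bump :: "real \<Rightarrow> real" where
  "cantor_bump x = (\<Sum>n. flat 0 (- 1/2 - cos (3 ^ n * x)) / fact n)"

definition cantor :: "real set" where
  "cantor = {x \<in> {0..2 * pi}. \<forall>n. cos (3 ^ n * x) \<ge> - 1/2}"

lemma periodic_bounded:
  fixes u :: "real \<Rightarrow> real"
  assumes "continuous_on UNIV u" "\<And>x. u (x + 2 * pi) = u x"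
  obtains C where "\<And>x. \<bar>u x\<bar> \<le> C"
proof -
  have "compact (u ` {0..2 * pi})"
    by (intro compact_continuous_image continuous_on_subset[OF assms(1)]) auto
  then obtain C where C: "\<And>x. x \<in> {0..2 * pi} \<Longrightarrow> \<bar>u x\<bar> \<le> C"
    by (force dest: compact_imp_bounded simp: bounded_iff)
  have up: "u (x + 2 * pi * real m) = u x" for x m
  proof (induction m)
    case (Suc m)
    then show ?case using assms(2)[of "x + 2 * pi * real m"] by (simp add: algebra_simps)
  qed simp
  have "\<bar>u x\<bar> \<le> C" for x
  proof -
    define j where "j = \<lfloor>x / (2 * pi)\<rfloor>"
    define y where "y = x - 2 * pi * of_int j"
    have "of_int j \<le> x / (2 * pi)" "x / (2 * pi) < of_int j + 1"
      unfolding j_def by linarith+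
    then have y: "y \<in> {0..2 * pi}"
      by (auto simp: y_def field_simps)
    have "u x = u y"
    proof (cases "j \<ge> 0")
      case True
      then show ?thesis using up[of y "nat j"] by (simp add: y_def)
    next
      case False
      then show ?thesis using up[of x "nat (- j)"] by (simp add: y_def)
    qed
    with C[OF y] show ?thesis by simp
  qed
  then show ?thesis by (rule that)
qed

text \<open>
  Differentiation turns the series for \<open>(a, u)\<close> into the one for \<open>(3 a, u')\<close>. The arbitrary factor
  \<open>a\<^sup>n\<close> is what makes this family of series stable under derivatives, and uniform convergence holds
  for each of them because \<open>u\<close> is bounded by periodicity.
\<close>

lemma smooth_periodic_series:
  assumes "smooth u" "\<And>x. u (x + 2 * pi) = u x"
  shows "summable (\<lambda>n. a ^ n / fact n * u (3 ^ n * x))"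
    and "smooth (\<lambda>x. \<Sum>n. a ^ n / fact n * u (3 ^ n * x))"
proof -
  have sm: "uniformly_convergent_on UNIV (\<lambda>N x. \<Sum>n<N. a ^ n / fact n * u (3 ^ n * x))"
    if u: "smooth u" "\<And>x. u (x + 2 * pi) = u x" for a and u :: "real \<Rightarrow> real"
  proof -
    obtain C where C: "\<And>x. \<bar>u x\<bar> \<le> C"
      using periodic_bounded[OF smooth_continuous[OF u(1)] u(2)] by blast
    have "summable (\<lambda>n. C * (inverse (fact n) * \<bar>a\<bar> ^ n))"
      by (intro summable_mult summable_exp)
    moreover have "norm (a ^ n / fact n * u (3 ^ n * x)) \<le> C * (inverse (fact n) * \<bar>a\<bar> ^ n)" for n x
      using mult_right_mono[OF C[of "3 ^ n * x"], of "\<bar>a\<bar> ^ n / fact n"]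
      by (simp add: abs_mult power_abs field_simps)
    ultimately show ?thesis
      by (intro Weierstrass_m_test')
  qed
  have su: "summable (\<lambda>n. a ^ n / fact n * u (3 ^ n * x))"
    if "smooth u" "\<And>x. u (x + 2 * pi) = u x" for a x and u :: "real \<Rightarrow> real"
    using uniformly_convergent_imp_convergent[of UNIV "\<lambda>N x. \<Sum>n<N. a ^ n / fact n * u (3 ^ n * x)" x, OF sm[OF that]]
    by (simp add: summable_iff_convergent)
  show "summable (\<lambda>n. a ^ n / fact n * u (3 ^ n * x))"
    by (rule su) (use assms in auto)
  show "smooth (\<lambda>x. \<Sum>n. a ^ n / fact n * u (3 ^ n * x))"
    using assms
  proof (coinduction arbitrary: a u)
    case smooth
    obtain v where v: "\<And>x. (u has_real_derivative v x) (at x)" "smooth v"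
      using smoothE[OF smooth(1)] by metis
    have per: "v (x + 2 * pi) = v x" for x
    proof (rule DERIV_unique)
      show "((\<lambda>x. u (x + 2 * pi)) has_real_derivative v (x + 2 * pi)) (at x)"
        using v(1)[of "x + 2 * pi"] by (simp add: DERIV_shift)
      show "((\<lambda>x. u (x + 2 * pi)) has_real_derivative v x) (at x)"
        using v(1)[of x] smooth(2) by simp
    qed
    have d: "((\<lambda>x. a ^ n / fact n * u (3 ^ n * x)) has_real_derivative
        (3 * a) ^ n / fact n * v (3 ^ n * x)) (at x)" for n x
      by (rule DERIV_cong[OF DERIV_cmult[OF DERIV_chain2[OF v(1) DERIV_cmult_Id]]])
        (simp add: power_mult_distrib)
    have s0: "summable (\<lambda>n. a ^ n / fact n * u (3 ^ n * 0))"
      using su smooth by blast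
    have "((\<lambda>x. \<Sum>n. a ^ n / fact n * u (3 ^ n * x)) has_real_derivative
        (\<Sum>n. (3 * a) ^ n / fact n * v (3 ^ n * x))) (at x)" for x
      using has_field_derivative_series'(2)[OF convex_UNIV d sm[OF v(2) per] UNIV_I s0]
      by simp
    with v(2) per show ?case
      by (rule_tac exI[of _ "\<lambda>x. \<Sum>n. a ^ n / fact n * u (3 ^ n * x)"],
          rule_tac exI[of _ "\<lambda>x. \<Sum>n. (3 * a) ^ n / fact n * v (3 ^ n * x)"])
        (intro conjI refl allI disjI1 exI[of _ "3 * a"] exI[of _ v]; (assumption | rule refl))
  qed
qed

lemma cantor_bump_series:
  fixes x :: real
  shows "summable (\<lambda>n. flat 0 (- 1/2 - cos (3 ^ n * x)) / fact n)" and "smooth cantor_bump"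
proof -
  have u: "smooth (\<lambda>x. flat 0 (- 1/2 + (- 1) * cos x))"
    by (intro smooth_compose[OF smooth_flat] smooth_intros)
  show "summable (\<lambda>n. flat 0 (- 1/2 - cos (3 ^ n * x)) / fact n)"
    using smooth_periodic_series(1)[OF u, of 1 x] by simp
  show "smooth cantor_bump"
    using smooth_periodic_series(2)[OF u, of 1] by (simp add: cantor_bump_def[abs_def])
qed

lemma cantor_bump_ge: "cantor_bump x \<ge> flat 0 (- 1/2 - cos (3 ^ n * x)) / fact n"
  unfolding cantor_bump_def
  using sum_le_suminf[OF cantor_bump_series(1), of "{n}" x] by (simp add: flat_nonneg)

lemma cantor_bump_nonneg: "cantor_bump x \<ge> 0"
  using cantor_bump_ge[where n = 0] flat_nonneg by (meson divide_nonneg_pos fact_gt_zero order_trans)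

text \<open>
  Each bump is at most \<open>exp(-2)\<close>, and the weights \<open>1 / n!\<close> add up to \<open>exp(1)\<close>. The bound by 1 makes
  the cap compensate, in \<open>bdry_degeneracy_ge\<close>, for the decay of the weight near \<open>w = 0\<close>.
\<close>

lemma cantor_bump_le_1: "cantor_bump x \<le> 1"
proof -
  have b: "flat 0 (- 1/2 - cos y) \<le> exp (- 2)" for y
  proof -
    have "- 1 \<le> cos y" by (rule cos_ge_minus_one)
    then have "flat 0 (- 1/2 - cos y) \<le> flat 0 (1/2)"
      by (intro flat_0_mono) linarith
    then show ?thesis by (simp add: flat_def)
  qed
  have le: "flat 0 (- 1/2 - cos (3 ^ n * x)) / fact n \<le> exp (- 2) * (inverse (fact n) * 1 ^ n)" for n
  proof -
    have "exp (- 2) * (inverse (fact n) * 1 ^ n) = exp (- 2) / (fact n :: real)"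
      by (simp add: field_simps)
    then show ?thesis using divide_right_mono[OF b, of "fact n" "3 ^ n * x"] by simp
  qed
  have "summable (\<lambda>n. exp (- 2) * (inverse (fact n) * 1 ^ n) :: real)"
    by (rule summable_mult[OF summable_exp])
  from suminf_le[OF le cantor_bump_series(1) this]
  have "cantor_bump x \<le> (\<Sum>n. exp (- 2) * (inverse (fact n) * 1 ^ n))"
    unfolding cantor_bump_def .
  also have "\<dots> = exp (- 2) * (\<Sum>n. inverse (fact n) * 1 ^ n)"
    by (rule suminf_mult[OF summable_exp])
  also have "\<dots> = exp (- 2) * exp 1"
    by (simp add: exp_def)
  also have "\<dots> \<le> 1" by (simp add: mult_exp_exp)
  finally show ?thesis .
qed

lemma cantor_bump_cantor: "x \<in> cantor \<Longrightarrow> cantor_bump x = 0"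
  by (simp add: cantor_bump_def cantor_def flat_nonpos_arg)

lemma cos_triple_scale: "cos (3 ^ Suc n * ((x + 4 * pi) / 3)) = cos (3 ^ n * x)"
proof -
  have "3 ^ Suc n * ((x + 4 * pi) / 3) = 3 ^ n * x + 2 * pi * of_int (2 * 3 ^ n)"
    by (simp add: field_simps)
  then show ?thesis by (simp only: cos_add cos_int_2pin sin_int_2pin)
qed

lemma cos_ge_neg_half:
  assumes "0 \<le> x" "x \<le> 2 * pi / 3"
  shows "cos x \<ge> - 1/2"
  using cos_monotone_0_pi_le[of x "2 * pi / 3"] assms cos_120 by simp

lemma cos_less_neg_half:
  assumes "2 * pi / 3 < x" "x < 4 * pi / 3"
  shows "cos x < - 1/2"
proof (cases "x \<le> pi")
  case True
  then show ?thesis using cos_monotone_0_pi[of "2 * pi / 3" x] assms cos_120 by simp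
next
  case False
  have "cos x = cos (2 * pi - x)" by (simp add: cos_diff)
  then show ?thesis using False cos_monotone_0_pi[of "2 * pi / 3" "2 * pi - x"] assms cos_120 by simp
qed

lemma cantor_contract:
  assumes "x \<in> cantor"
  shows "x / 3 \<in> cantor" "(x + 4 * pi) / 3 \<in> cantor"
proof -
  from assms have x: "0 \<le> x" "x \<le> 2 * pi" and c: "cos (3 ^ n * x) \<ge> - 1/2" for n
    by (auto simp: cantor_def)
  have "cos (3 ^ n * (x / 3)) \<ge> - 1/2" for n
    using c[of "n - 1"] cos_ge_neg_half[of "x / 3"] x by (cases n) auto
  then show "x / 3 \<in> cantor" using x by (auto simp: cantor_def)
  have "cos ((x + 4 * pi) / 3) = cos (2 * pi - (x + 4 * pi) / 3)"
    by (simp add: cos_diff)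
  also have "2 * pi - (x + 4 * pi) / 3 = (2 * pi - x) / 3" by (simp add: field_simps)
  also have "cos \<dots> \<ge> - 1/2"
    using x by (intro cos_ge_neg_half) auto
  finally have "cos (3 ^ n * ((x + 4 * pi) / 3)) \<ge> - 1/2" for n
    using c[of "n - 1"] cos_triple_scale[of "n - 1" x] by (cases n) auto
  then show "(x + 4 * pi) / 3 \<in> cantor" using x by (auto simp: cantor_def)
qed

lemma cantor_expand:
  assumes "x \<in> cantor"
  obtains y where "y \<in> cantor" "x = y / 3" | y where "y \<in> cantor" "x = (y + 4 * pi) / 3"
proof -
  from assms have x: "0 \<le> x" "x \<le> 2 * pi" and c: "cos (3 ^ n * x) \<ge> - 1/2" for n
    by (auto simp: cantor_def)
  show ?thesis
  proof (cases "x \<le> 2 * pi / 3")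
    case True
    have "cos (3 ^ n * (3 * x)) \<ge> - 1/2" for n
      using c[of "Suc n"] by (simp add: mult.assoc mult.left_commute)
    then have "3 * x \<in> cantor" using True x by (auto simp: cantor_def)
    then show ?thesis by (intro that(1)[of "3 * x"]) auto
  next
    case False
    then have "x \<ge> 4 * pi / 3" using cos_less_neg_half[of x] c[of 0] by force
    moreover have "cos (3 ^ n * (3 * x - 4 * pi)) \<ge> - 1/2" for n
      using c[of "Suc n"] cos_triple_scale[of n "3 * x - 4 * pi"] by simp
    ultimately have "3 * x - 4 * pi \<in> cantor" using x by (auto simp: cantor_def)
    then show ?thesis by (intro that(2)[of "3 * x - 4 * pi"]) auto
  qed
qed

lemma zero_in_cantor: "0 \<in> cantor"
  by (simp add: cantor_def)

text \<open>
  Self-similarity: every point of the Cantor set lies in one of the \<open>2\<^sup>n\<close> copies of it with size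
  \<open>2 \<pi> / 3\<^sup>n\<close>, and each copy contains two different end points.
\<close>

lemma cantor_near: "x \<in> cantor \<Longrightarrow> \<exists>y\<in>cantor. y \<noteq> x \<and> \<bar>y - x\<bar> \<le> 2 * pi / 3 ^ n"
proof (induction n arbitrary: x)
  case 0
  have "cos (3 ^ n * (2 * pi)) = 1" for n :: nat
    using cos_int_2pin[of "3 ^ n"] by (simp add: mult.commute)
  then have "2 * pi \<in> cantor" by (simp add: cantor_def)
  moreover have "0 \<le> x" "x \<le> 2 * pi" using 0 by (auto simp: cantor_def)
  ultimately show ?case
    using zero_in_cantor
    by (cases "x = 0") (intro bexI[of _ "2 * pi"], auto intro!: bexI[of _ 0])
next
  case (Suc n)
  from cantor_expand[OF Suc.prems] show ?case
  proof cases
    case (1 x1)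
    obtain y where "y \<in> cantor" "y \<noteq> x1" "\<bar>y - x1\<bar> \<le> 2 * pi / 3 ^ n"
      using Suc.IH[OF 1(1)] by blast
    then show ?thesis
      using cantor_contract(1)[of y] 1 by (intro bexI[of _ "y / 3"]) (auto simp: field_simps abs_if)
  next
    case (2 x1)
    obtain y where "y \<in> cantor" "y \<noteq> x1" "\<bar>y - x1\<bar> \<le> 2 * pi / 3 ^ n"
      using Suc.IH[OF 2(1)] by blast
    then show ?thesis
      using cantor_contract(2)[of y] 2
      by (intro bexI[of _ "(y + 4 * pi) / 3"]) (auto simp: field_simps abs_if)
  qed
qed

lemma cantor_perfect:
  assumes "x \<in> cantor"
  shows "x islimpt cantor"
  unfolding islimpt_approachable
proof (intro allI impI)
  fix e :: real assume "e > 0"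
  have "((\<lambda>n. 2 * pi / 3 ^ n) \<longlongrightarrow> 0) sequentially"
    by (rule LIMSEQ_divide_realpow_zero) simp
  with \<open>e > 0\<close> obtain n where "2 * pi / 3 ^ n < e"
    by (metis (mono_tags, lifting) eventually_happens' order_tendstoD(2) sequentially_bot)
  with cantor_near[OF assms, of n] show "\<exists>y\<in>cantor. y \<noteq> x \<and> dist y x < e"
    by (force simp: dist_real_def)
qed

section \<open>A flat convex cap\<close>

text \<open>
  With \<open>B(s) = s exp(-1/s)\<close> for \<open>s > 0\<close> one has \<open>B'(s) = (1 + 1/s) exp(-1/s)\<close> and
  \<open>B''(s) = exp(-1/s) / s\<^sup>3\<close>, so \<open>B\<close>, extended by \<open>0\<close>, is smooth, convex and nondecreasing, and hence
  \<open>B(t\<^sup>2 - 64)\<close> is convex. The constant 64 makes it vanish for \<open>\<bar>t\<bar> \<le> 8\<close>, an interval that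
  contains the Cantor set because \<open>2 \<pi> < 8\<close>. The three definitions are this function and its first two
  derivatives.
\<close>

definition cap :: "real \<Rightarrow> real" where
  "cap t = (t^2 - 64) * flat 0 (t^2 - 64)"

definition cap' :: "real \<Rightarrow> real" where
  "cap' t = 2 * t * (flat 0 (t^2 - 64) + flat 1 (t^2 - 64))"

definition cap'' :: "real \<Rightarrow> real" where
  "cap'' t = 2 * (flat 0 (t^2 - 64) + flat 1 (t^2 - 64)) + 4 * t^2 * flat 3 (t^2 - 64)"

lemma flat_Suc: "s * flat (Suc n) s = flat n s"
  by (simp add: flat_def)

lemma cap_derivative: "(cap has_real_derivative cap' t) (at t)"
proof -
  let ?s = "t^2 - 64"
  have s: "((\<lambda>t. t^2 - 64) has_real_derivative 2 * t) (at t)"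
    by (auto intro!: derivative_eq_intros)
  have "?s * flat (Suc (Suc 0)) ?s = flat (Suc 0) ?s"
    by (rule flat_Suc)
  then show ?thesis
    unfolding cap_def[abs_def] cap'_def
    by (intro DERIV_cong[OF DERIV_mult[OF s DERIV_chain2[OF flat_derivative s]]])
      (simp add: distrib_left mult_ac)
qed

lemma cap'_derivative: "(cap' has_real_derivative cap'' t) (at t)"
proof -
  have s: "((\<lambda>t. t^2 - 64) has_real_derivative 2 * t) (at t)"
    by (auto intro!: derivative_eq_intros)
  show ?thesis
    unfolding cap'_def[abs_def] cap''_def
    by (rule DERIV_cong[OF DERIV_mult[OF DERIV_cmult_Id
          DERIV_add[OF DERIV_chain2[OF flat_derivative s] DERIV_chain2[OF flat_derivative s]]]])
      (simp add: algebra_simps numeral_2_eq_2 numeral_3_eq_3 power2_eq_square)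
qed

lemma smooth_cap: "smooth cap"
proof -
  have "smooth (\<lambda>t. (t * t + (- 64)) * flat 0 (t * t + (- 64)))"
    by (intro smooth_mult smooth_compose[OF smooth_flat] smooth_intros)
  then show ?thesis by (simp add: cap_def[abs_def] power2_eq_square)
qed

lemma cap_nonneg: "cap t \<ge> 0"
  by (cases "t^2 - 64 > 0") (auto simp: cap_def flat_nonneg flat_nonpos_arg)

lemma cap_pos_iff: "cap t > 0 \<longleftrightarrow> t^2 > 64"
  by (cases "t^2 - 64 > 0") (auto simp: cap_def flat_pos flat_nonpos_arg)

lemma cap_zero: "\<bar>t\<bar> \<le> 8 \<Longrightarrow> cap t = 0"
  using power_mono[of "\<bar>t\<bar>" 8 2] by (simp add: cap_def flat_nonpos_arg)

lemma cap_mono: "s^2 \<le> t^2 \<Longrightarrow> cap s \<le> cap t"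
  by (cases "s^2 > 64")
    (auto simp: cap_def flat_nonneg flat_0_mono cap_nonneg[unfolded cap_def] flat_nonpos_arg intro!: mult_mono)

lemma cap_strict_mono:
  assumes "s^2 < t^2" "cap t > 0"
  shows "cap s < cap t"
proof (cases "s^2 > 64")
  case True
  then have "cap s < (t^2 - 64) * flat 0 (s^2 - 64)"
    using assms by (simp add: cap_def flat_pos)
  also have "\<dots> \<le> cap t" using assms True unfolding cap_def
    by (intro mult_left_mono flat_0_mono) auto
  finally show ?thesis .
next
  case False
  then have "cap s = 0" by (simp add: cap_def flat_nonpos_arg)
  with assms show ?thesis by simp
qed

text \<open>This bounds the domain: \<open>2 exp(-1/2) > 1\<close>, so that the cap exceeds 1 from \<open>t\<^sup>2 = 66\<close> onwards.\<close>

lemma cap_le_1: 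
  assumes "cap t \<le> 1"
  shows "t^2 < 66"
proof (rule ccontr)
  assume "\<not> ?thesis"
  then have t: "t^2 - 64 \<ge> 2" by simp
  have "exp (1/2 :: real) ^ 2 < 2 ^ 2"
    using exp_le by (simp add: exp_double[symmetric])
  then have "exp (1/2 :: real) < 2"
    by (rule power_less_imp_less_base) simp
  then have "1 < 2 * exp (- (1/2 :: real))" by (simp add: exp_minus field_simps)
  also have "\<dots> = 2 * flat 0 2" by (simp add: flat_def)
  also have "\<dots> \<le> cap t"
    unfolding cap_def using t by (intro mult_mono flat_0_mono) (auto simp: flat_nonneg)
  finally show False using assms by simp
qed

lemma cap_le_cap'': 
  assumes "cap t \<le> 1"
  shows "cap t \<le> cap'' t"
proof -
  have "cap t \<le> 2 * flat 0 (t^2 - 64)"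
    unfolding cap_def using cap_le_1[OF assms] by (intro mult_right_mono) (auto simp: flat_nonneg)
  also have "\<dots> \<le> cap'' t"
    by (simp add: cap''_def flat_nonneg)
  finally show ?thesis .
qed

lemma cap'_nonzero: "cap t > 0 \<Longrightarrow> cap' t \<noteq> 0"
proof -
  assume "cap t > 0"
  then have "t^2 > 64" by (simp add: cap_pos_iff)
  then have "t \<noteq> 0" "flat 0 (t^2 - 64) + flat 1 (t^2 - 64) > 0"
    by (auto intro!: add_pos_pos flat_pos)
  then show ?thesis by (simp add: cap'_def)
qed

section \<open>Calculus on \<open>\<complex>\<^sup>n\<close>\<close>

text \<open>
  Only finitely many coordinates are free on \<open>Cn n\<close>, so that the product topology has uniform boxes as
  neighbourhoods; this replaces the Euclidean metric in all limit arguments.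
\<close>

lemma open_Cn_box:
  assumes "open_Cn n W" "p \<in> W"
  shows "\<exists>\<delta>>0. \<forall>z\<in>Cn n. (\<forall>i<n. cmod (z i - p i) < \<delta>) \<longrightarrow> z \<in> W"
proof -
  obtain T where T: "open T" "W = Cn n \<inter> T"
    using assms(1) unfolding open_Cn_def openin_open by blast
  have "openin (product_topology (\<lambda>i. euclidean) UNIV) T"
    using T(1) by (simp add: open_fun_def)
  moreover have "p \<in> T" using assms(2) T(2) by blast
  ultimately obtain X where X0: "p \<in> Pi\<^sub>E UNIV X" "\<forall>i. openin euclidean (X i)" "Pi\<^sub>E UNIV X \<subseteq> T"
    using product_topology_open_contains_basis by meson
  have X: "p \<in> Pi\<^sub>E UNIV X" "\<And>i. open (X i)" "Pi\<^sub>E UNIV X \<subseteq> T"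
    using X0 by simp_all
  have "\<forall>i. \<exists>d>0. ball (p i) d \<subseteq> X i"
    using X by (auto simp: open_contains_ball)
  then obtain d where d: "\<And>i. d i > 0" "\<And>i. ball (p i) (d i) \<subseteq> X i" by metis
  define \<delta> where "\<delta> = Min (insert 1 (d ` {..<n}))"
  have "\<delta> > 0" unfolding \<delta>_def using d by (subst Min_gr_iff) auto
  moreover have "z \<in> W" if z: "z \<in> Cn n" "\<And>i. i < n \<Longrightarrow> cmod (z i - p i) < \<delta>" for z
  proof -
    have "z i \<in> X i" for i
    proof (cases "i < n")
      case True
      then have "\<delta> \<le> d i" unfolding \<delta>_def by (intro Min_le) auto
      then have "z i \<in> ball (p i) (d i)" using z(2)[OF True] by (simp add: dist_norm norm_minus_commute)
      then show ?thesis using d by blast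
    next
      case False
      then have "z i = p i" using z(1) assms(2) T by (simp add: Cn_def)
      then show ?thesis using X(1) by auto
    qed
    then show ?thesis using X z T by (auto simp: PiE_def extensional_def)
  qed
  ultimately show ?thesis by blast
qed

lemma continuous_on_box:
  fixes g :: "cvec \<Rightarrow> real"
  assumes "open_Cn n U" "continuous_on U g" "p \<in> U" "e > 0"
  shows "\<exists>\<delta>>0. \<forall>z\<in>Cn n. (\<forall>i<n. cmod (z i - p i) < \<delta>) \<longrightarrow> z \<in> U \<and> \<bar>g z - g p\<bar> < e"
proof -
  have "openin (top_of_set U) (U \<inter> g -` ball (g p) e)"
    by (rule continuous_openin_preimage_gen[OF assms(2)]) simp
  then have "open_Cn n (U \<inter> g -` ball (g p) e)"
    using assms(1) unfolding open_Cn_def by (rule openin_trans)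
  from open_Cn_box[OF this, of p] show ?thesis
    using assms(3,4) by (auto simp: dist_real_def abs_minus_commute)
qed

lemma shift_shift: "shift (shift z v s) v t = shift z v (s + t)"
  by (auto simp: shift_def algebra_simps)

lemma shift_in_Cn: "z \<in> Cn n \<Longrightarrow> v \<in> Cn n \<Longrightarrow> shift z v t \<in> Cn n"
  by (simp add: Cn_def shift_def)

lemma coord_in_Cn: "j < n \<Longrightarrow> coord j c \<in> Cn n"
  by (simp add: Cn_def coord_def)

lemma C1_mean_value:
  assumes "C_k n 1 U f" "j < n" "c \<in> {1, \<i>}"
    and "\<And>\<theta>. 0 \<le> \<theta> \<Longrightarrow> \<theta> \<le> 1 \<Longrightarrow> shift q (coord j c) (\<theta> * r) \<in> U"
  shows "\<exists>\<theta>\<in>{0..1}. f (shift q (coord j c) r) - f q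
    = r * dir_deriv f (shift q (coord j c) (\<theta> * r)) (coord j c)"
proof -
  let ?e = "coord j c"
  have "((\<lambda>\<theta>. f (shift q ?e (\<theta> * r))) has_real_derivative
      dir_deriv f (shift q ?e (\<theta> * r)) ?e * r) (at \<theta>)" if "0 \<le> \<theta>" "\<theta> \<le> 1" for \<theta>
  proof -
    let ?z = "shift q ?e (\<theta> * r)"
    have "(\<lambda>t. f (shift ?z ?e t)) differentiable at 0"
      using assms that by auto
    then have "((\<lambda>t. f (shift ?z ?e t)) has_real_derivative dir_deriv f ?z ?e) (at 0)"
      unfolding dir_deriv_def has_real_derivative_iff_has_vector_derivative
      using vector_derivative_works by blast
    then have "((\<lambda>t. f (shift q ?e (\<theta> * r + t))) has_real_derivative dir_deriv f ?z ?e) (at 0)"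
      by (simp add: shift_shift)
    then have "((\<lambda>t. f (shift q ?e t)) has_real_derivative dir_deriv f ?z ?e) (at (\<theta> * r))"
      using DERIV_shift[of "\<lambda>t. f (shift q ?e t)" "dir_deriv f ?z ?e" 0 "\<theta> * r"]
      by (simp add: add.commute)
    from DERIV_chain2[OF this DERIV_cmult_Id[of r, unfolded mult.commute[of r]]]
    show ?thesis by (simp add: mult.commute)
  qed
  from MVT2[OF zero_less_one this] obtain \<theta> where "0 < \<theta>" "\<theta> < 1"
    "f (shift q ?e (1 * r)) - f (shift q ?e (0 * r)) = (1 - 0) * (dir_deriv f (shift q ?e (\<theta> * r)) ?e * r)"
    by auto
  moreover have "shift q ?e 0 = q" by (simp add: shift_def)
  ultimately show ?thesis by (intro bexI[of _ \<theta>]) (auto simp: mult.commute)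
qed

text \<open>
  A moving point \<open>q(s) \<rightarrow> p\<close> is displaced by \<open>r(s)\<close> in one real coordinate direction. The mean value
  theorem and the continuity of the partial derivative give the rate of change of \<open>f\<close>. Four
  such displacements lead from \<open>p\<close> to a point of a curve in \<open>\<complex>\<^sup>2\<close>, which yields the chain rule
  \<open>C1_curve\<close> without a total derivative.
\<close>

lemma C1_step:
  fixes f :: "cvec \<Rightarrow> real"
  assumes U: "open_Cn n U" "C_k n 1 U f" "p \<in> U" and j: "j < n" "c \<in> {1, \<i>}"
    and q: "\<And>s. q s \<in> Cn n" "\<And>i. i < n \<Longrightarrow> ((\<lambda>s. q s i) \<longlongrightarrow> p i) (at 0)"
    and r: "((\<lambda>s. r s / s) \<longlongrightarrow> r') (at 0)" "(r \<longlongrightarrow> 0) (at (0::real))"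
  shows "((\<lambda>s. (f (shift (q s) (coord j c) (r s)) - f (q s)) / s) \<longlongrightarrow> r' * dir_deriv f p (coord j c)) (at 0)"
proof -
  define e where "e = coord j c"
  define g where "g z = dir_deriv f z e" for z
  have c1: "cmod c = 1" using j by auto
  have gcont: "continuous_on U g"
    using U(2) j unfolding g_def e_def by auto
  have near: "\<forall>\<^sub>F s in at 0. \<forall>\<theta>\<in>{0..1}. shift (q s) e (\<theta> * r s) \<in> U \<and> \<bar>g (shift (q s) e (\<theta> * r s)) - g p\<bar> < \<epsilon>"
    if "\<epsilon> > 0" for \<epsilon>
  proof -
    obtain \<delta> where \<delta>: "\<delta> > 0"
      "\<And>z. z \<in> Cn n \<Longrightarrow> (\<And>i. i < n \<Longrightarrow> cmod (z i - p i) < \<delta>) \<Longrightarrow> z \<in> U \<and> \<bar>g z - g p\<bar> < \<epsilon>"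
      using continuous_on_box[OF U(1) gcont U(3) \<open>\<epsilon> > 0\<close>] by blast
    have "\<forall>\<^sub>F s in at 0. \<forall>i\<in>{..<n}. cmod (q s i - p i) < \<delta> / 2"
      using tendstoD[OF q(2), of _ "\<delta> / 2"] \<delta>(1)
      by (intro eventually_ball_finite ballI) (simp_all add: dist_norm)
    moreover have "\<forall>\<^sub>F s in at 0. \<bar>r s\<bar> < \<delta> / 2"
      using tendstoD[OF r(2), of "\<delta> / 2"] \<delta>(1) by (simp add: dist_real_def)
    ultimately show ?thesis
    proof eventually_elim
      case (elim s)
      show ?case
      proof (intro ballI \<delta>(2))
        fix \<theta> :: real assume \<theta>: "\<theta> \<in> {0..1}"
        show "shift (q s) e (\<theta> * r s) \<in> Cn n"
          unfolding e_def by (intro shift_in_Cn q coord_in_Cn j)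
        fix i assume "i < n"
        have "cmod (shift (q s) e (\<theta> * r s) i - p i) \<le> cmod (q s i - p i) + cmod (of_real (\<theta> * r s) * e i)"
          unfolding shift_def by (metis add_diff_eq add.commute norm_triangle_ineq)
        also have "cmod (of_real (\<theta> * r s) * e i) \<le> \<bar>r s\<bar>"
          using \<theta> c1 by (auto simp: e_def coord_def norm_mult abs_mult mult_left_le_one_le)
        finally show "cmod (shift (q s) e (\<theta> * r s) i - p i) < \<delta>"
          using elim \<open>i < n\<close> by force
      qed
    qed
  qed
  define T where "T s = (SOME \<theta>. \<theta> \<in> {0..1} \<and> f (shift (q s) e (r s)) - f (q s) = r s * g (shift (q s) e (\<theta> * r s)))" for s
  have T: "\<forall>\<^sub>F s in at 0. T s \<in> {0..1} \<and> f (shift (q s) e (r s)) - f (q s) = r s * g (shift (q s) e (T s * r s))"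
    using near[OF zero_less_one]
  proof eventually_elim
    case (elim s)
    then have "\<exists>\<theta>. \<theta> \<in> {0..1} \<and> f (shift (q s) e (r s)) - f (q s) = r s * g (shift (q s) e (\<theta> * r s))"
      using C1_mean_value[OF U(2) j, of "q s" "r s"] unfolding e_def g_def by force
    then show ?case unfolding T_def by (rule someI_ex)
  qed
  have "((\<lambda>s. g (shift (q s) e (T s * r s))) \<longlongrightarrow> g p) (at 0)"
  proof (rule tendstoI)
    fix \<epsilon> :: real assume "\<epsilon> > 0"
    from near[OF this] T show "\<forall>\<^sub>F s in at 0. dist (g (shift (q s) e (T s * r s))) (g p) < \<epsilon>"
      by eventually_elim (auto simp: dist_real_def)
  qed
  from tendsto_mult[OF r(1) this]
  have "((\<lambda>s. r s / s * g (shift (q s) e (T s * r s))) \<longlongrightarrow> r' * g p) (at 0)" .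
  moreover have "\<forall>\<^sub>F s in at 0. r s / s * g (shift (q s) e (T s * r s)) = (f (shift (q s) e (r s)) - f (q s)) / s"
    using T by eventually_elim simp
  ultimately show ?thesis
    unfolding g_def e_def by (rule Lim_transform_eventually)
qed

definition differential :: "(cvec \<Rightarrow> real) \<Rightarrow> cvec \<Rightarrow> complex \<Rightarrow> complex \<Rightarrow> real" where
  "differential f p a b = Re a * dir_deriv f p (coord 0 1) + Im a * dir_deriv f p (coord 0 \<i>)
    + Re b * dir_deriv f p (coord 1 1) + Im b * dir_deriv f p (coord 1 \<i>)"

lemma C1_curve:
  fixes f :: "cvec \<Rightarrow> real" and \<gamma> :: "real \<Rightarrow> cvec"
  assumes U: "open_Cn 2 U" "C_k 2 1 U f" "p \<in> U"
    and \<gamma>: "\<And>s. \<gamma> s \<in> Cn 2" "\<gamma> 0 = p"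
      "((\<lambda>s. \<gamma> s 0) has_vector_derivative a) (at 0)" "((\<lambda>s. \<gamma> s 1) has_vector_derivative b) (at 0)"
  shows "((\<lambda>s. f (\<gamma> s)) has_real_derivative differential f p a b) (at 0)"
proof -
  define x where "x s = Re (\<gamma> s 0 - p 0)" for s
  define y where "y s = Im (\<gamma> s 0 - p 0)" for s
  define u where "u s = Re (\<gamma> s 1 - p 1)" for s
  define v where "v s = Im (\<gamma> s 1 - p 1)" for s
  define q1 where "q1 s = shift p (coord 0 1) (x s)" for s
  define q2 where "q2 s = shift (q1 s) (coord 0 \<i>) (y s)" for s
  define q3 where "q3 s = shift (q2 s) (coord 1 1) (u s)" for s
  have der: "(x has_real_derivative Re a) (at 0)" "(y has_real_derivative Im a) (at 0)"
    "(u has_real_derivative Re b) (at 0)" "(v has_real_derivative Im b) (at 0)"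
    unfolding x_def y_def u_def v_def has_real_derivative_iff_has_vector_derivative minus_complex.simps
    using bounded_linear.has_vector_derivative[OF bounded_linear_Re \<gamma>(3)]
      bounded_linear.has_vector_derivative[OF bounded_linear_Im \<gamma>(3)]
      bounded_linear.has_vector_derivative[OF bounded_linear_Re \<gamma>(4)]
      bounded_linear.has_vector_derivative[OF bounded_linear_Im \<gamma>(4)]
    by (auto intro!: has_vector_derivative_diff_const[THEN iffD2])
  have zero: "x 0 = 0" "y 0 = 0" "u 0 = 0" "v 0 = 0"
    by (simp_all add: x_def y_def u_def v_def \<gamma>(2))
  have quot: "((\<lambda>s. r s / s) \<longlongrightarrow> r') (at 0)" and lim: "(r \<longlongrightarrow> 0) (at 0)"
    if "(r has_real_derivative r') (at 0)" "r 0 = 0" for r r'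
    using that DERIV_isCont[OF that(1)] by (auto simp: has_field_derivative_iff isCont_def)
  have p: "p \<in> Cn 2" using \<gamma> by metis
  have Cn: "q1 s \<in> Cn 2" "q2 s \<in> Cn 2" "q3 s \<in> Cn 2" for s
    unfolding q1_def q2_def q3_def using p by (auto intro!: shift_in_Cn coord_in_Cn)
  have last: "\<gamma> s = shift (q3 s) (coord 1 \<i>) (v s)" for s
  proof
    fix i
    show "\<gamma> s i = shift (q3 s) (coord 1 \<i>) (v s) i"
    proof (cases "i < 2")
      case True
      then have "i = 0 \<or> i = 1" by auto
      then show ?thesis
        by (auto simp: shift_def coord_def q3_def q2_def q1_def x_def y_def u_def v_def complex_eq_iff)
    next
      case False
      then have "\<gamma> s i = 0" "shift (q3 s) (coord 1 \<i>) (v s) i = 0"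
        using \<gamma>(1)[of s] Cn(3)[of s] by (auto simp: Cn_def shift_def coord_def)
      then show ?thesis by simp
    qed
  qed
  have lims: "((\<lambda>s. q1 s i) \<longlongrightarrow> p i) (at 0)" "((\<lambda>s. q2 s i) \<longlongrightarrow> p i) (at 0)"
      "((\<lambda>s. q3 s i) \<longlongrightarrow> p i) (at 0)" for i
    unfolding q3_def q2_def q1_def shift_def
    using der zero by (auto intro!: tendsto_eq_intros lim)
  note st = C1_step[OF U, where r = x and r' = "Re a" and q = "\<lambda>_. p" and j = 0 and c = 1]
    C1_step[OF U, where r = y and r' = "Im a" and q = q1 and j = 0 and c = \<i>]
    C1_step[OF U, where r = u and r' = "Re b" and q = q2 and j = 1 and c = 1]
    C1_step[OF U, where r = v and r' = "Im b" and q = q3 and j = 1 and c = \<i>]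
  have "((\<lambda>s. (f (q1 s) - f p) / s) \<longlongrightarrow> Re a * dir_deriv f p (coord 0 1)) (at 0)"
    using st(1) p quot[OF der(1) zero(1)] lim[OF der(1) zero(1)] by (simp add: q1_def)
  moreover have "((\<lambda>s. (f (q2 s) - f (q1 s)) / s) \<longlongrightarrow> Im a * dir_deriv f p (coord 0 \<i>)) (at 0)"
    using st(2) Cn lims quot[OF der(2) zero(2)] lim[OF der(2) zero(2)] by (simp add: q2_def)
  moreover have "((\<lambda>s. (f (q3 s) - f (q2 s)) / s) \<longlongrightarrow> Re b * dir_deriv f p (coord 1 1)) (at 0)"
    using st(3) Cn lims quot[OF der(3) zero(3)] lim[OF der(3) zero(3)] by (simp add: q3_def)
  moreover have "((\<lambda>s. (f (\<gamma> s) - f (q3 s)) / s) \<longlongrightarrow> Im b * dir_deriv f p (coord 1 \<i>)) (at 0)"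
    using st(4) Cn lims quot[OF der(4) zero(4)] lim[OF der(4) zero(4)] by (simp add: last)
  ultimately have "((\<lambda>s. (f (q1 s) - f p) / s + (f (q2 s) - f (q1 s)) / s + (f (q3 s) - f (q2 s)) / s
      + (f (\<gamma> s) - f (q3 s)) / s) \<longlongrightarrow> differential f p a b) (at 0)"
    unfolding differential_def by (intro tendsto_add)
  moreover have "(f (q1 s) - f p) / s + (f (q2 s) - f (q1 s)) / s + (f (q3 s) - f (q2 s)) / s
      + (f (\<gamma> s) - f (q3 s)) / s = (f (\<gamma> s) - f (\<gamma> 0)) / (s - 0)" for s
    by (simp add: \<gamma>(2) flip: add_divide_distrib)
  ultimately show ?thesis by (simp add: has_field_derivative_iff)
qed

section \<open>Functions of Hartogs type\<close>

text \<open>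
  A class of functions that contains everything used below and is visibly closed under real
  partial derivatives, so that membership implies \<open>C_k\<close> for every \<open>k\<close>.
\<close>

inductive_set csmooth :: "(cvec \<Rightarrow> real) set" where
  Re: "smooth u \<Longrightarrow> (\<lambda>z. u (Re (z j))) \<in> csmooth"
| Im: "smooth u \<Longrightarrow> (\<lambda>z. u (Im (z j))) \<in> csmooth"
| add: "f \<in> csmooth \<Longrightarrow> g \<in> csmooth \<Longrightarrow> (\<lambda>z. f z + g z) \<in> csmooth"
| mult: "f \<in> csmooth \<Longrightarrow> g \<in> csmooth \<Longrightarrow> (\<lambda>z. f z * g z) \<in> csmooth"

lemma csmooth_continuous: "f \<in> csmooth \<Longrightarrow> continuous_on U f"
proof (induction rule: csmooth.induct)
  case (Re u j)
  have "continuous_on U (\<lambda>z. Re (z j))"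
    by (intro continuous_intros continuous_on_subset[OF continuous_on_product_coordinates]) auto
  then show ?case
    by (rule continuous_on_compose2[OF smooth_continuous[OF Re, of UNIV]]) auto
next
  case (Im u j)
  have "continuous_on U (\<lambda>z. Im (z j))"
    by (intro continuous_intros continuous_on_subset[OF continuous_on_product_coordinates]) auto
  then show ?case
    by (rule continuous_on_compose2[OF smooth_continuous[OF Im, of UNIV]]) auto
qed (auto intro: continuous_intros)

lemma shift_0: "shift z v 0 = z"
  by (simp add: shift_def)

lemma csmooth_derivative:
  assumes "f \<in> csmooth"
  shows "\<exists>f'\<in>csmooth. \<forall>z. ((\<lambda>t. f (shift z (coord i c) t)) has_real_derivative f' z) (at 0)"
  using assms
proof induction
  case (Re u j)
  then obtain u' where u': "\<And>x. (u has_real_derivative u' x) (at x)" "smooth u'"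
    using smoothE by metis
  let ?c = "Re (coord i c j)"
  have "((\<lambda>t. u (Re (shift z (coord i c) t j))) has_real_derivative u' (Re (z j)) * ?c) (at 0)" for z
  proof -
    have "((\<lambda>t. Re (shift z (coord i c) t j)) has_real_derivative ?c) (at 0)"
      unfolding shift_def by (auto intro!: derivative_eq_intros)
    from DERIV_chain2[OF _ this] u'(1) show ?thesis by (simp add: shift_0)
  qed
  then show ?case
    using smooth_mult[OF u'(2) smooth_const[of ?c], THEN csmooth.Re[where j = j]] by (intro bexI) auto
next
  case (Im u j)
  then obtain u' where u': "\<And>x. (u has_real_derivative u' x) (at x)" "smooth u'"
    using smoothE by metis
  let ?c = "Im (coord i c j)"
  have "((\<lambda>t. u (Im (shift z (coord i c) t j))) has_real_derivative u' (Im (z j)) * ?c) (at 0)" for z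
  proof -
    have "((\<lambda>t. Im (shift z (coord i c) t j)) has_real_derivative ?c) (at 0)"
      unfolding shift_def by (auto intro!: derivative_eq_intros)
    from DERIV_chain2[OF _ this] u'(1) show ?thesis by (simp add: shift_0)
  qed
  then show ?case
    using smooth_mult[OF u'(2) smooth_const[of ?c], THEN csmooth.Im[where j = j]] by (intro bexI) auto
next
  case (add f g)
  then obtain f' g' where "f' \<in> csmooth" "\<forall>z. ((\<lambda>t. f (shift z (coord i c) t)) has_real_derivative f' z) (at 0)"
    "g' \<in> csmooth" "\<forall>z. ((\<lambda>t. g (shift z (coord i c) t)) has_real_derivative g' z) (at 0)" by blast
  then show ?case
    by (intro bexI[of _ "\<lambda>z. f' z + g' z"]) (auto intro!: derivative_intros csmooth.add)
next
  case (mult f g)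
  then obtain f' g' where f'g': "f' \<in> csmooth" "\<And>z. ((\<lambda>t. f (shift z (coord i c) t)) has_real_derivative f' z) (at 0)"
    "g' \<in> csmooth" "\<And>z. ((\<lambda>t. g (shift z (coord i c) t)) has_real_derivative g' z) (at 0)" by blast
  show ?case
  proof (intro bexI allI)
    show "((\<lambda>t. f (shift z (coord i c) t) * g (shift z (coord i c) t)) has_real_derivative
      f' z * g z + g' z * f z) (at 0)" for z
      using DERIV_mult[OF f'g'(2,4), of z z] by (simp add: shift_0)
    show "(\<lambda>z. f' z * g z + g' z * f z) \<in> csmooth"
      by (intro csmooth.add csmooth.mult f'g' mult.hyps)
  qed
qed

lemma csmooth_C_k: "f \<in> csmooth \<Longrightarrow> C_k n k U f"
proof (induction k arbitrary: f)
  case 0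
  then show ?case by (simp add: csmooth_continuous)
next
  case (Suc k)
  have "(\<forall>z\<in>U. (\<lambda>t. f (shift z (coord j c) t)) differentiable (at 0)) \<and>
        C_k n k U (\<lambda>z. dir_deriv f z (coord j c))" for j c
  proof -
    obtain f' where f': "f' \<in> csmooth"
      "\<And>z. ((\<lambda>t. f (shift z (coord j c) t)) has_vector_derivative f' z) (at 0)"
      using csmooth_derivative[OF Suc.prems, of j c]
      unfolding has_real_derivative_iff_has_vector_derivative by blast
    then have "(\<lambda>z. dir_deriv f z (coord j c)) = f'"
      unfolding dir_deriv_def by (intro ext vector_derivative_at)
    with f' Suc.IH show ?thesis
      by (auto intro: differentiableI_vector)
  qed
  then show ?case by (simp add: csmooth_continuous[OF Suc.prems])
qed

text \<open>
  Both the defining function and the functions for property (P) have the form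
  \<open>\<bar>w\<bar>\<^sup>2 u(x) + a(x) + c(y)\<close>, so that one computation of the Hessian serves for both.
\<close>

definition hartogs :: "(real \<Rightarrow> real) \<Rightarrow> (real \<Rightarrow> real) \<Rightarrow> (real \<Rightarrow> real) \<Rightarrow> cvec \<Rightarrow> real" where
  "hartogs u a c z = (cmod (z 1))\<^sup>2 * u (Re (z 0)) + a (Re (z 0)) + c (Im (z 0))"

lemma hartogs_csmooth:
  assumes "smooth u" "smooth a" "smooth c"
  shows "hartogs u a c \<in> csmooth"
proof -
  have sq: "smooth (\<lambda>x. x * x)" by (intro smooth_intros)
  have "(\<lambda>z. (Re (z 1) * Re (z 1) + Im (z 1) * Im (z 1)) * u (Re (z 0)) + a (Re (z 0)) + c (Im (z 0))) \<in> csmooth"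
    by (intro csmooth.add csmooth.mult csmooth.Re[OF assms(1)] csmooth.Re[OF assms(2)] csmooth.Im[OF assms(3)]
        csmooth.Re[OF sq] csmooth.Im[OF sq])
  moreover have "(\<lambda>z. (Re (z 1) * Re (z 1) + Im (z 1) * Im (z 1)) * u (Re (z 0)) + a (Re (z 0)) + c (Im (z 0))) = hartogs u a c"
    by (simp add: hartogs_def[abs_def] cmod_power2 flip: power2_eq_square)
  ultimately show ?thesis by simp
qed

lemma dir_deriv_eqI:
  assumes "((\<lambda>t. Re (f (shift z v t))) has_real_derivative Re D) (at 0)"
    "((\<lambda>t. Im (f (shift z v t))) has_real_derivative Im D) (at 0)"
  shows "dir_deriv f z v = D"
proof -
  have "((\<lambda>t. of_real (Re (f (shift z v t))) + \<i> * of_real (Im (f (shift z v t)))) has_vector_derivative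
      of_real (Re D) + \<i> * of_real (Im D)) (at 0)"
    by (intro has_vector_derivative_add has_vector_derivative_mult_right has_vector_derivative_of_real assms)
  then show ?thesis
    unfolding dir_deriv_def by (intro vector_derivative_at) (simp flip: complex_eq)
qed

context
  fixes u u' u'' a a' a'' c c' c'' :: "real \<Rightarrow> real"
  assumes der: "\<And>x. (u has_real_derivative u' x) (at x)" "\<And>x. (u' has_real_derivative u'' x) (at x)"
    "\<And>x. (a has_real_derivative a' x) (at x)" "\<And>x. (a' has_real_derivative a'' x) (at x)"
    "\<And>x. (c has_real_derivative c' x) (at x)" "\<And>x. (c' has_real_derivative c'' x) (at x)"
begin

lemma der_chain:
  assumes "(g has_real_derivative g') (at 0)"
  shows "((\<lambda>t. u (g t)) has_real_derivative u' (g 0) * g') (at 0)"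
    "((\<lambda>t. u' (g t)) has_real_derivative u'' (g 0) * g') (at 0)"
    "((\<lambda>t. a (g t)) has_real_derivative a' (g 0) * g') (at 0)"
    "((\<lambda>t. a' (g t)) has_real_derivative a'' (g 0) * g') (at 0)"
    "((\<lambda>t. c (g t)) has_real_derivative c' (g 0) * g') (at 0)"
    "((\<lambda>t. c' (g t)) has_real_derivative c'' (g 0) * g') (at 0)"
  using DERIV_chain2[OF der(1) assms] DERIV_chain2[OF der(2) assms] DERIV_chain2[OF der(3) assms]
    DERIV_chain2[OF der(4) assms] DERIV_chain2[OF der(5) assms] DERIV_chain2[OF der(6) assms]
  by auto

lemma hartogs_real_derivative:
  "((\<lambda>t. hartogs u a c (shift z (coord 0 1) t)) has_real_derivative
      (cmod (z 1))\<^sup>2 * u' (Re (z 0)) + a' (Re (z 0))) (at 0)"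
  "((\<lambda>t. hartogs u a c (shift z (coord 0 \<i>) t)) has_real_derivative c' (Im (z 0))) (at 0)"
  "((\<lambda>t. hartogs u a c (shift z (coord 1 1) t)) has_real_derivative 2 * Re (z 1) * u (Re (z 0))) (at 0)"
  "((\<lambda>t. hartogs u a c (shift z (coord 1 \<i>) t)) has_real_derivative 2 * Im (z 1) * u (Re (z 0))) (at 0)"
  unfolding hartogs_def shift_def coord_def cmod_power2
  by (auto intro!: derivative_eq_intros der_chain)

lemma hartogs_d_zbar:
  "d_zbar 0 (\<lambda>z. of_real (hartogs u a c z)) =
    (\<lambda>z. Complex (((cmod (z 1))\<^sup>2 * u' (Re (z 0)) + a' (Re (z 0))) / 2) (c' (Im (z 0)) / 2))"
  "d_zbar 1 (\<lambda>z. of_real (hartogs u a c z)) = (\<lambda>z. Complex (Re (z 1) * u (Re (z 0))) (Im (z 1) * u (Re (z 0))))"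
proof -
  have "dir_deriv (\<lambda>z. complex_of_real (hartogs u a c z)) z (coord 0 1) = of_real ((cmod (z 1))\<^sup>2 * u' (Re (z 0)) + a' (Re (z 0)))"
    "dir_deriv (\<lambda>z. complex_of_real (hartogs u a c z)) z (coord 0 \<i>) = of_real (c' (Im (z 0)))"
    "dir_deriv (\<lambda>z. complex_of_real (hartogs u a c z)) z (coord 1 1) = of_real (2 * Re (z 1) * u (Re (z 0)))"
    "dir_deriv (\<lambda>z. complex_of_real (hartogs u a c z)) z (coord 1 \<i>) = of_real (2 * Im (z 1) * u (Re (z 0)))" for z
    by (rule dir_deriv_eqI; simp only: Re_complex_of_real Im_complex_of_real hartogs_real_derivative DERIV_const)+
  then show "d_zbar 0 (\<lambda>z. of_real (hartogs u a c z)) =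
    (\<lambda>z. Complex (((cmod (z 1))\<^sup>2 * u' (Re (z 0)) + a' (Re (z 0))) / 2) (c' (Im (z 0)) / 2))"
    "d_zbar 1 (\<lambda>z. of_real (hartogs u a c z)) = (\<lambda>z. Complex (Re (z 1) * u (Re (z 0))) (Im (z 1) * u (Re (z 0))))"
    by (simp_all add: d_zbar_def fun_eq_iff complex_eq_iff)
qed

lemma hartogs_d_z_d_zbar:
  "d_z 0 (d_zbar 0 (\<lambda>z. of_real (hartogs u a c z))) z
    = of_real (((cmod (z 1))\<^sup>2 * u'' (Re (z 0)) + a'' (Re (z 0)) + c'' (Im (z 0))) / 4)"
  "d_z 1 (d_zbar 0 (\<lambda>z. of_real (hartogs u a c z))) z = cnj (z 1) * of_real (u' (Re (z 0))) / 2"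
  "d_z 0 (d_zbar 1 (\<lambda>z. of_real (hartogs u a c z))) z = z 1 * of_real (u' (Re (z 0))) / 2"
  "d_z 1 (d_zbar 1 (\<lambda>z. of_real (hartogs u a c z))) z = of_real (u (Re (z 0)))"
proof -
  let ?f0 = "\<lambda>z. Complex (((cmod (z 1))\<^sup>2 * u' (Re (z 0)) + a' (Re (z 0))) / 2) (c' (Im (z 0)) / 2)"
  let ?f1 = "\<lambda>z. Complex (Re (z 1) * u (Re (z 0))) (Im (z 1) * u (Re (z 0)))"
  have "dir_deriv ?f0 z (coord 0 1) = of_real (((cmod (z 1))\<^sup>2 * u'' (Re (z 0)) + a'' (Re (z 0))) / 2)"
    "dir_deriv ?f0 z (coord 0 \<i>) = Complex 0 (c'' (Im (z 0)) / 2)"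
    "dir_deriv ?f0 z (coord 1 1) = of_real (Re (z 1) * u' (Re (z 0)))"
    "dir_deriv ?f0 z (coord 1 \<i>) = of_real (Im (z 1) * u' (Re (z 0)))"
    "dir_deriv ?f1 z (coord 0 1) = Complex (Re (z 1) * u' (Re (z 0))) (Im (z 1) * u' (Re (z 0)))"
    "dir_deriv ?f1 z (coord 0 \<i>) = 0"
    "dir_deriv ?f1 z (coord 1 1) = of_real (u (Re (z 0)))"
    "dir_deriv ?f1 z (coord 1 \<i>) = Complex 0 (u (Re (z 0)))"
    by (rule dir_deriv_eqI; auto intro!: derivative_eq_intros der_chain simp: shift_def coord_def cmod_power2)+
  then show "d_z 0 (d_zbar 0 (\<lambda>z. of_real (hartogs u a c z))) z
    = of_real (((cmod (z 1))\<^sup>2 * u'' (Re (z 0)) + a'' (Re (z 0)) + c'' (Im (z 0))) / 4)"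
  "d_z 1 (d_zbar 0 (\<lambda>z. of_real (hartogs u a c z))) z = cnj (z 1) * of_real (u' (Re (z 0))) / 2"
  "d_z 0 (d_zbar 1 (\<lambda>z. of_real (hartogs u a c z))) z = z 1 * of_real (u' (Re (z 0))) / 2"
  "d_z 1 (d_zbar 1 (\<lambda>z. of_real (hartogs u a c z))) z = of_real (u (Re (z 0)))"
    unfolding hartogs_d_zbar d_z_def by (simp_all add: complex_eq_iff field_simps)
qed

lemma hartogs_hessian:
  "complex_hessian 2 (hartogs u a c) z \<xi> \<eta> =
    of_real (u (Re (z 0))) * \<xi> 1 * cnj (\<eta> 1)
    + of_real (u' (Re (z 0))) / 2 * (z 1 * \<xi> 0 * cnj (\<eta> 1) + cnj (z 1) * \<xi> 1 * cnj (\<eta> 0))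
    + of_real (((cmod (z 1))\<^sup>2 * u'' (Re (z 0)) + a'' (Re (z 0)) + c'' (Im (z 0))) / 4) * \<xi> 0 * cnj (\<eta> 0)"
proof -
  have "{..<2::nat} = {0, 1}" by auto
  then show ?thesis
    unfolding complex_hessian_def
    by (simp add: hartogs_d_z_d_zbar[unfolded One_nat_def] algebra_simps)
qed

end

lemma cnorm_2: "(cnorm 2 z)\<^sup>2 = (cmod (z 0))\<^sup>2 + (cmod (z 1))\<^sup>2"
proof -
  have "{..<2::nat} = {0, 1}" by auto
  then show ?thesis by (simp add: cnorm_def L2_set_def)
qed

section \<open>The domain\<close>

text \<open>
  The exponent \<open>h\<close> of the weight is any second antiderivative of \<open>cantor_bump\<close>; \<open>h1\<close> is its derivative.
\<close>

locale cantor_weight =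
  fixes h h1 :: "real \<Rightarrow> real"
  assumes h: "smooth h" "\<And>x. (h has_real_derivative h1 x) (at x)"
    and h1: "smooth h1" "\<And>x. (h1 has_real_derivative cantor_bump x) (at x)"
begin

definition rho :: "cvec \<Rightarrow> real" where
  "rho = hartogs (\<lambda>x. exp (h x)) (\<lambda>x. cap x - 1) cap"

definition Omega :: "cvec set" where
  "Omega = {z \<in> Cn 2. rho z < 0}"

lemma rho_eq: "rho z = (cmod (z 1))\<^sup>2 * exp (h (Re (z 0))) + cap (Re (z 0)) + cap (Im (z 0)) - 1"
  by (simp add: rho_def hartogs_def)

lemma smooth_exp_h: "smooth (\<lambda>x. M * exp (h x))"
  by (intro smooth_intros h)

lemma rho_csmooth: "rho \<in> csmooth"
  unfolding rho_def
proof (rule hartogs_csmooth)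
  show "smooth (\<lambda>x. exp (h x))" using smooth_exp_h[of 1] by simp
  show "smooth (\<lambda>x. cap x - 1)" using smooth_add[OF smooth_cap smooth_const[of "-1"]] by simp
qed (rule smooth_cap)

lemma rho_continuous: "continuous_on U rho"
  by (rule csmooth_continuous[OF rho_csmooth])

lemma open_Omega: "open_Cn 2 Omega"
proof -
  have "Omega = Cn 2 \<inter> rho -` {..<0}" by (auto simp: Omega_def)
  then show ?thesis
    unfolding open_Cn_def using continuous_openin_preimage_gen[OF rho_continuous, of "{..<0}" "Cn 2"] by simp
qed

lemma fun_upd_Cn: "z \<in> Cn n \<Longrightarrow> j < n \<Longrightarrow> z(j := c) \<in> Cn n"
  by (auto simp: Cn_def)

lemma rho_upd_1_le:
  assumes "0 \<le> s" "s \<le> 1"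
  shows "rho (z(1 := of_real s * z 1)) \<le> rho z"
proof -
  have "(s * cmod (z 1))\<^sup>2 \<le> (cmod (z 1))\<^sup>2"
    using assms by (intro power_mono mult_left_le_one_le) auto
  then show ?thesis using assms by (simp add: rho_eq norm_mult)
qed

lemma rho_upd_0_le:
  assumes "0 \<le> s" "s \<le> 1" "z 1 = 0"
  shows "rho (z(0 := of_real s * z 0)) \<le> rho z"
proof -
  have "cap (s * x) \<le> cap x" for x
    using assms by (intro cap_mono) (simp add: power_mult_distrib mult_left_le_one_le power_le_one)
  then show ?thesis using assms(3) by (simp add: rho_eq add_mono)
qed

text \<open>
  Every point with \<open>\<rho> = 0\<close> is a limit of points with \<open>\<rho> < 0\<close>: shrink \<open>w\<close> if \<open>w \<noteq> 0\<close>, and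
  otherwise shrink \<open>x\<close> and \<open>y\<close>, at least one of which lies where the cap is positive and strictly
  increasing in the absolute value.
\<close>

lemma rho_upd_less:
  assumes "rho z = 0"
  obtains j where "j < 2" "\<And>s. 0 \<le> s \<Longrightarrow> s < 1 \<Longrightarrow> rho (z(j := of_real s * z j)) < 0"
proof (cases "z 1 = 0")
  case False
  have "rho (z(1 := of_real s * z 1)) < 0" if "0 \<le> s" "s < 1" for s
  proof -
    have "(s * cmod (z 1))\<^sup>2 < (cmod (z 1))\<^sup>2"
      using that False by (intro power_strict_mono) auto
    then have l: "(s * cmod (z 1))\<^sup>2 * exp (h (Re (z 0))) < (cmod (z 1))\<^sup>2 * exp (h (Re (z 0)))"
      by simp
    have "rho (z(1 := of_real s * z 1)) =
        (s * cmod (z 1))\<^sup>2 * exp (h (Re (z 0))) + cap (Re (z 0)) + cap (Im (z 0)) - 1"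
      using that by (simp add: rho_eq norm_mult)
    with l assms show ?thesis unfolding rho_eq by linarith
  qed
  then show ?thesis using that[of 1] by simp
next
  case True
  have "rho (z(0 := of_real s * z 0)) < 0" if s: "0 \<le> s" "s < 1" for s
  proof -
    have le: "cap (s * x) \<le> cap x" for x
      using s by (intro cap_mono) (simp add: power_mult_distrib mult_left_le_one_le power_le_one)
    have less: "cap (s * x) < cap x" if "cap x > 0" for x
    proof (rule cap_strict_mono[OF _ that])
      have "x^2 > 0" using that unfolding cap_pos_iff by linarith
      moreover have "s^2 < 1" using s by (simp add: power_less_one_iff abs_square_less_1)
      ultimately show "(s * x)\<^sup>2 < x\<^sup>2" by (simp add: power_mult_distrib)
    qed
    have "cap (Re (z 0)) + cap (Im (z 0)) = 1" using assms True by (simp add: rho_eq)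
    then have "cap (Re (z 0)) > 0 \<or> cap (Im (z 0)) > 0" by linarith
    then have "cap (s * Re (z 0)) + cap (s * Im (z 0)) < 1"
      using le[of "Re (z 0)"] le[of "Im (z 0)"] less[of "Re (z 0)"] less[of "Im (z 0)"]
        \<open>cap (Re (z 0)) + cap (Im (z 0)) = 1\<close> by linarith
    then show ?thesis using True by (simp add: rho_eq)
  qed
  then show ?thesis using that[of 0] by simp
qed

lemma bdry_Omega: "bdry 2 Omega = {z \<in> Cn 2. rho z = 0}"
proof -
  have int: "top_of_set (Cn 2) interior_of Omega = Omega"
    using open_Omega unfolding open_Cn_def by (simp add: interior_of_openin)
  have "closedin (top_of_set (Cn 2)) (Cn 2 \<inter> rho -` {..0})"
    by (rule continuous_closedin_preimage[OF rho_continuous]) simp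
  then have clos: "top_of_set (Cn 2) closure_of Omega \<subseteq> Cn 2 \<inter> rho -` {..0}"
    by (intro closure_of_minimal) (auto simp: Omega_def)
  have "z \<in> top_of_set (Cn 2) closure_of Omega" if z: "z \<in> Cn 2" "rho z = 0" for z
    unfolding in_closure_of
  proof (intro conjI allI impI)
    fix T assume T: "z \<in> T \<and> openin (top_of_set (Cn 2)) T"
    then obtain \<delta> where \<delta>: "\<delta> > 0" "\<And>y. y \<in> Cn 2 \<Longrightarrow> (\<And>i. i < 2 \<Longrightarrow> cmod (y i - z i) < \<delta>) \<Longrightarrow> y \<in> T"
      using open_Cn_box[of 2 T z] unfolding open_Cn_def by blast
    obtain j where j: "j < 2" "\<And>s. 0 \<le> s \<Longrightarrow> s < 1 \<Longrightarrow> rho (z(j := of_real s * z j)) < 0"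
      using rho_upd_less[OF z(2)] by blast
    \<comment> \<open>a contraction of the coordinate \<open>j\<close> by \<open>1 - t\<close> moves \<open>z\<close> by less than \<open>\<delta>\<close>\<close>
    define t where "t = min 1 (\<delta> / (cmod (z j) + 1))"
    have t: "0 < t" "t \<le> 1" "t * (cmod (z j) + 1) \<le> \<delta>"
      using \<delta>(1) norm_ge_zero[of "z j"] 
      by (auto simp: t_def min_def field_simps add_pos_nonneg)
    define y where "y = z(j := of_real (1 - t) * z j)"
    have "rho y < 0" unfolding y_def by (rule j(2)) (use t in auto)
    moreover have y: "y \<in> Cn 2" unfolding y_def by (rule fun_upd_Cn[OF z(1) j(1)])
    moreover have "y \<in> T"
    proof (rule \<delta>(2)[OF y])
      fix i :: nat
      have "of_real (1 - t) * z j - z j = - (of_real t * z j)" by (simp add: algebra_simps)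
      then have "cmod (of_real (1 - t) * z j - z j) = t * cmod (z j)"
        using t by (simp only: norm_minus_cancel norm_mult norm_of_real)
      also have "\<dots> < \<delta>" using t by (simp add: distrib_left)
      finally show "cmod (y i - z i) < \<delta>" using \<delta>(1) by (simp add: y_def)
    qed
    ultimately show "\<exists>y. y \<in> Omega \<and> y \<in> T" by (auto simp: Omega_def)
  qed (use z in auto)
  with clos show ?thesis
    unfolding bdry_def frontier_of_def int by (auto simp: Omega_def)
qed

text \<open>Shrinking first \<open>w\<close> and then \<open>x + \<i> y\<close> to \<open>0\<close> stays in the domain.\<close>

lemma connected_Omega: "connected Omega"
proof -
  have upd: "connected_component Omega z (z(j := 0))"
    if "\<And>s. 0 \<le> s \<Longrightarrow> s \<le> 1 \<Longrightarrow> z(j := of_real s * z j) \<in> Omega" for z j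
  proof -
    let ?g = "\<lambda>s::real. z(j := of_real s * z j)"
    have "continuous_on {0..1} ?g"
    proof (rule continuous_on_coordinatewise_then_product)
      show "continuous_on {0..1} (\<lambda>s. ?g s i)" for i
        by (cases "i = j") (auto intro!: continuous_intros)
    qed
    then have "connected (?g ` {0..1})"
      by (rule connected_continuous_image) simp
    moreover have "?g ` {0..1} \<subseteq> Omega" using that by auto
    moreover have "z \<in> ?g ` {0..1}" by (rule image_eqI[of _ _ 1]) auto
    moreover have "z(j := 0) \<in> ?g ` {0..1}" by (rule image_eqI[of _ _ 0]) auto
    ultimately show ?thesis unfolding connected_component_def by blast
  qed
  have "connected_component Omega z (\<lambda>_. 0)" if z: "z \<in> Omega" for z
  proof -
    have z2: "z \<in> Cn 2" "rho z < 0" using z by (auto simp: Omega_def)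
    have 1: "z(1 := of_real s * z 1) \<in> Omega" if "0 \<le> s" "s \<le> 1" for s
      using rho_upd_1_le[OF that, of z] z2 fun_upd_Cn[of z 2 1] by (auto simp: Omega_def)
    define y where "y = z(1 := 0)"
    have y: "y \<in> Cn 2" "rho y < 0" "y 1 = 0"
      using 1[of 0] by (auto simp: Omega_def y_def)
    have 2: "y(0 := of_real s * y 0) \<in> Omega" if "0 \<le> s" "s \<le> 1" for s
      using rho_upd_0_le[OF that, of y] y fun_upd_Cn[of y 2 0] by (auto simp: Omega_def)
    have "y(0 := 0) = (\<lambda>_. 0)"
      using z2(1) by (auto simp: y_def Cn_def fun_eq_iff not_le numeral_2_eq_2 less_Suc_eq)
    with upd[OF 1] upd[OF 2] show ?thesis
      unfolding y_def by (metis connected_component_trans)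
  qed
  then show ?thesis
    unfolding connected_iff_connected_component
    by (meson connected_component_sym connected_component_trans)
qed

lemma weight_bounds:
  obtains \<mu> H where "\<mu> > 0" "\<And>x. x^2 < 66 \<Longrightarrow> exp (h x) \<ge> \<mu>" "\<And>x. x^2 < 66 \<Longrightarrow> (h1 x)\<^sup>2 \<le> H"
proof -
  have in9: "x \<in> {-9..9}" if "x^2 < 66" for x :: real
    using that abs_le_square_iff[of x 9] by auto
  have "continuous_on {-9..9} (\<lambda>x. exp (h x))" "continuous_on {-9..9} (\<lambda>x. (h1 x)\<^sup>2)"
    by (intro continuous_intros smooth_continuous h h1)+
  then obtain x1 x2 where "\<forall>x\<in>{-9..9}. exp (h x1) \<le> exp (h x)" "\<forall>x\<in>{-9..9}. (h1 x)\<^sup>2 \<le> (h1 x2)\<^sup>2"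
    using continuous_attains_inf[of "{-9..9::real}" "\<lambda>x. exp (h x)"]
      continuous_attains_sup[of "{-9..9::real}" "\<lambda>x. (h1 x)\<^sup>2"] by auto
  then show ?thesis using in9 by (intro that[of "exp (h x1)" "(h1 x2)\<^sup>2"]) auto
qed

lemma rho_le_0_bounds:
  assumes "rho z \<le> 0"
  shows "cap (Re (z 0)) \<le> 1" "cap (Im (z 0)) \<le> 1" "(cmod (z 1))\<^sup>2 * exp (h (Re (z 0))) \<le> 1"
    "(Re (z 0))\<^sup>2 < 66" "(Im (z 0))\<^sup>2 < 66"
proof -
  have "(cmod (z 1))\<^sup>2 * exp (h (Re (z 0))) \<ge> 0" by simp
  then show *: "cap (Re (z 0)) \<le> 1" "cap (Im (z 0)) \<le> 1" "(cmod (z 1))\<^sup>2 * exp (h (Re (z 0))) \<le> 1"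
    using assms cap_nonneg[of "Re (z 0)"] cap_nonneg[of "Im (z 0)"] unfolding rho_eq by linarith+
  show "(Re (z 0))\<^sup>2 < 66" "(Im (z 0))\<^sup>2 < 66"
    using * cap_le_1 by blast+
qed

lemma bounded_domain_Omega: "bounded_domain 2 Omega"
proof -
  obtain \<mu> H where \<mu>: "\<mu> > 0" "\<And>x. x^2 < 66 \<Longrightarrow> exp (h x) \<ge> \<mu>"
    using weight_bounds by metis
  have "cnorm 2 z \<le> sqrt (132 + 1 / \<mu>)" if "z \<in> Omega" for z
  proof (rule real_le_rsqrt)
    have r: "rho z \<le> 0" using that by (auto simp: Omega_def)
    have "(cmod (z 1))\<^sup>2 * \<mu> \<le> (cmod (z 1))\<^sup>2 * exp (h (Re (z 0)))"
      using \<mu>(2)[OF rho_le_0_bounds(4)[OF r]] by (intro mult_left_mono) auto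
    also have "\<dots> \<le> 1" by (rule rho_le_0_bounds(3)[OF r])
    finally have "(cmod (z 1))\<^sup>2 \<le> 1 / \<mu>" using \<mu>(1) by (simp add: field_simps)
    then show "(cnorm 2 z)\<^sup>2 \<le> 132 + 1 / \<mu>"
      using rho_le_0_bounds(4,5)[OF r] unfolding cnorm_2 cmod_power2[of "z 0"] by linarith
  qed
  moreover have "(\<lambda>_. 0) \<in> Omega"
    by (simp add: Omega_def Cn_def rho_eq cap_zero)
  ultimately show ?thesis
    unfolding bounded_domain_def using open_Omega connected_Omega by blast
qed

lemma exp_h_derivative:
  "((\<lambda>x. M * exp (h x)) has_real_derivative M * exp (h x) * h1 x) (at x)"
  "((\<lambda>x. M * exp (h x) * h1 x) has_real_derivative M * exp (h x) * ((h1 x)\<^sup>2 + cantor_bump x)) (at x)"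
  by (auto intro!: derivative_eq_intros DERIV_chain2[OF DERIV_exp] h(2) h1(2)
      simp: power2_eq_square algebra_simps)

text \<open>
  Since \<open>(exp h)'' = exp h (h'\<^sup>2 + f)\<close>, the terms with \<open>h'\<close> complete the square
  \<open>\<bar>\<xi>\<^sub>1 + w h'/2 \<xi>\<^sub>0\<bar>\<^sup>2\<close>. The factor \<open>M\<close> allows multiples of the defining function.
\<close>

lemma weighted_hessian:
  assumes "\<And>x. (a has_real_derivative a' x) (at x)" "\<And>x. (a' has_real_derivative a'' x) (at x)"
    "\<And>x. (c has_real_derivative c' x) (at x)" "\<And>x. (c' has_real_derivative c'' x) (at x)"
  shows "complex_hessian 2 (hartogs (\<lambda>x. M * exp (h x)) a c) z \<xi> \<eta> =
    of_real (M * exp (h (Re (z 0)))) * (\<xi> 1 + of_real (h1 (Re (z 0)) / 2) * z 1 * \<xi> 0)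
      * cnj (\<eta> 1 + of_real (h1 (Re (z 0)) / 2) * z 1 * \<eta> 0)
    + of_real ((M * ((cmod (z 1))\<^sup>2 * exp (h (Re (z 0)))) * cantor_bump (Re (z 0))
        + a'' (Re (z 0)) + c'' (Im (z 0))) / 4) * (\<xi> 0 * cnj (\<eta> 0))"
proof -
  have *: "complex_of_real (cmod (z (Suc 0))) * complex_of_real (cmod (z (Suc 0))) = z (Suc 0) * cnj (z (Suc 0))"
    using complex_norm_square[of "z (Suc 0)"] by (simp add: power2_eq_square)
  show ?thesis
    unfolding hartogs_hessian[OF exp_h_derivative assms]
    by (simp add: algebra_simps power2_eq_square add_divide_distrib *)
qed

lemma weighted_levi_form:
  assumes "\<And>x. (a has_real_derivative a' x) (at x)" "\<And>x. (a' has_real_derivative a'' x) (at x)"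
    "\<And>x. (c has_real_derivative c' x) (at x)" "\<And>x. (c' has_real_derivative c'' x) (at x)"
  shows "Re (complex_hessian 2 (hartogs (\<lambda>x. M * exp (h x)) a c) z \<xi> \<xi>) =
    M * exp (h (Re (z 0))) * (cmod (\<xi> 1 + of_real (h1 (Re (z 0)) / 2) * z 1 * \<xi> 0))\<^sup>2
    + (M * ((cmod (z 1))\<^sup>2 * exp (h (Re (z 0)))) * cantor_bump (Re (z 0))
        + a'' (Re (z 0)) + c'' (Im (z 0))) / 4 * (cmod (\<xi> 0))\<^sup>2"
  unfolding weighted_hessian[OF assms] mult.assoc complex_norm_square[symmetric]
  by (simp flip: of_real_mult of_real_add of_real_divide of_real_power)

lemma cap''_nonneg: "cap'' t \<ge> 0"
  by (simp add: cap''_def flat_nonneg)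

lemma cap_minus_1_derivative: "((\<lambda>x. cap x - 1) has_real_derivative cap' t) (at t)"
  by (auto intro!: derivative_eq_intros cap_derivative)

lemma rho_hartogs: "rho = hartogs (\<lambda>x. 1 * exp (h x)) (\<lambda>x. cap x - 1) cap"
  by (simp add: rho_def)

lemmas rho_derivs = cap_minus_1_derivative cap'_derivative cap_derivative cap'_derivative

lemma defining_function_rho: "defining_function 2 Omega (Cn 2) rho"
  unfolding defining_function_def
proof (intro conjI ballI)
  show "open_Cn 2 (Cn 2)" by (simp add: open_Cn_def)
  show "C_infinity 2 (Cn 2) rho" by (simp add: C_infinity_def csmooth_C_k[OF rho_csmooth])
  show "bdry 2 Omega = {z \<in> Cn 2. rho z = 0}" "bdry 2 Omega \<subseteq> Cn 2"
    by (auto simp: bdry_Omega)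
  show "Omega \<inter> Cn 2 = {z \<in> Cn 2. rho z < 0}"
    by (auto simp: Omega_def)
  fix p assume "p \<in> bdry 2 Omega"
  then have p: "rho p = 0" by (simp add: bdry_Omega)
  note der = hartogs_real_derivative[OF exp_h_derivative rho_derivs, of 1, folded rho_hartogs]
  note dd = der[THEN has_real_derivative_iff_has_vector_derivative[THEN iffD1], THEN vector_derivative_at,
      folded dir_deriv_def]
  show "\<exists>v\<in>Cn 2. dir_deriv rho p v \<noteq> 0"
  proof (cases "p 1 = 0")
    case True
    with p have "cap (Re (p 0)) + cap (Im (p 0)) = 1" by (simp add: rho_eq)
    then have "cap (Re (p 0)) > 0 \<or> cap (Im (p 0)) > 0" by linarith
    then have "dir_deriv rho p (coord 0 1) \<noteq> 0 \<or> dir_deriv rho p (coord 0 \<i>) \<noteq> 0"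
      using True cap'_nonzero by (auto simp: dd)
    then show ?thesis using coord_in_Cn[of 0 2] by auto
  next
    case False
    then have "Re (p 1) \<noteq> 0 \<or> Im (p 1) \<noteq> 0" by (simp add: complex_eq_iff)
    then have "dir_deriv rho p (coord 1 1) \<noteq> 0 \<or> dir_deriv rho p (coord 1 \<i>) \<noteq> 0"
      by (auto simp: dd[unfolded One_nat_def])
    then show ?thesis using coord_in_Cn[of 1 2] by auto
  qed
qed

lemma pseudoconvex_Omega: "pseudoconvex 2 Omega"
  unfolding pseudoconvex_def
proof (intro exI conjI ballI)
  show "defining_function 2 Omega (Cn 2) rho" by (rule defining_function_rho)
  show "Re (complex_hessian 2 rho p \<xi> \<xi>) \<ge> 0" for p \<xi>
    unfolding rho_hartogs weighted_levi_form[OF rho_derivs]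
    by (simp add: cantor_bump_nonneg cap''_nonneg)
qed

end

section \<open>Property (P)\<close>

text \<open>
  Put \<open>c = cos(3\<^sup>m x)\<close>. The second derivative of \<open>ripple\<close> is \<open>9\<^sup>m / 8\<close> times the cubic
  \<open>2 c\<^sup>3 - 2 c\<^sup>2 - c/2 + 1\<close> (\<open>ripple''_cubic\<close>), chosen as a combination of the Chebyshev polynomials of
  degrees 1 to 3, hence without mean value over a period, that is positive for \<open>c \<ge> -1/2\<close>. Being at
  least \<open>1/10\<close> even for \<open>c \<ge> -3/5\<close>, it leaves a margin: where this fails, \<open>cantor_bump\<close> is
  bounded below.
\<close>

definition ripple :: "nat \<Rightarrow> real \<Rightarrow> real" where
  "ripple m x = cos (2 * (3 ^ m * x)) / 32 - cos (3 ^ m * x) / 8 - cos (3 * (3 ^ m * x)) / 144"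

definition ripple' :: "nat \<Rightarrow> real \<Rightarrow> real" where
  "ripple' m x = 3 ^ m * (sin (3 ^ m * x) - sin (2 * (3 ^ m * x)) / 2 + sin (3 * (3 ^ m * x)) / 6) / 8"

definition ripple'' :: "nat \<Rightarrow> real \<Rightarrow> real" where
  "ripple'' m x = 9 ^ m * (cos (3 ^ m * x) - cos (2 * (3 ^ m * x)) + cos (3 * (3 ^ m * x)) / 2) / 8"

lemma ripple_derivative: "(ripple m has_real_derivative ripple' m x) (at x)"
  unfolding ripple_def[abs_def] ripple'_def
  by (auto intro!: derivative_eq_intros simp: field_simps)

lemma ripple'_derivative: "(ripple' m has_real_derivative ripple'' m x) (at x)"
proof -
  have "(9::real) ^ m = 3 ^ m * 3 ^ m" by (simp flip: power_mult_distrib)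
  then show ?thesis
    unfolding ripple'_def[abs_def] ripple''_def
    by (auto intro!: derivative_eq_intros simp: field_simps)
qed

lemma smooth_ripple: "smooth (ripple m)"
proof -
  have "smooth (\<lambda>x. cos (2 * (3 ^ m * x)) * (1/32) + (-1/8) * cos (3 ^ m * x)
      + (-1/144) * cos (3 * (3 ^ m * x)))"
    by (intro smooth_intros)
  then show ?thesis by (simp add: ripple_def[abs_def] algebra_simps)
qed

lemma abs_ripple: "\<bar>ripple m x\<bar> \<le> 1/4"
  unfolding ripple_def
  using abs_cos_le_one[of "2 * (3 ^ m * x)"] abs_cos_le_one[of "3 ^ m * x"]
    abs_cos_le_one[of "3 * (3 ^ m * x)"]
  by linarith

lemma ripple''_cubic:
  "ripple'' m x = 9 ^ m / 8 * (2 * cos (3 ^ m * x) ^ 3 - 2 * (cos (3 ^ m * x))\<^sup>2 - cos (3 ^ m * x) / 2 + 1)"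
proof -
  have "cos (2 * (3 ^ m * x)) = 2 * (cos (3 ^ m * x))\<^sup>2 - 1" by (rule cos_double_cos)
  moreover have "cos (3 * (3 ^ m * x)) = 4 * cos (3 ^ m * x) ^ 3 - 3 * cos (3 ^ m * x)"
    by (rule cos_treble_cos)
  ultimately have "cos (3 ^ m * x) - cos (2 * (3 ^ m * x)) + cos (3 * (3 ^ m * x)) / 2
      = 2 * cos (3 ^ m * x) ^ 3 - 2 * (cos (3 ^ m * x))\<^sup>2 - cos (3 ^ m * x) / 2 + 1"
    by linarith
  then show ?thesis unfolding ripple''_def by simp
qed

lemma ripple''_large:
  assumes "cos (3 ^ m * x) \<ge> - 3/5"
  shows "ripple'' m x \<ge> 9 ^ m / 80"
proof -
  define c where "c = cos (3 ^ m * x)"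
  \<comment> \<open>division of the cubic by \<open>c + 3/5\<close>; the quotient is positive\<close>
  have "2 * c ^ 3 - 2 * c\<^sup>2 - c / 2 + 1 = 148/1000 + (c + 3/5) * (2 * (c - 4/5)\<^sup>2 + 14/100)"
    by (simp add: power2_eq_square power3_eq_cube field_simps)
  moreover have "(c + 3/5) * (2 * (c - 4/5)\<^sup>2 + 14/100) \<ge> 0"
    using assms by (intro mult_nonneg_nonneg) (auto simp: c_def)
  ultimately have "2 * c ^ 3 - 2 * c\<^sup>2 - c / 2 + 1 \<ge> 1/10" by linarith
  from mult_left_mono[OF this, of "9 ^ m / 8"] show ?thesis
    unfolding ripple''_cubic c_def[symmetric] by simp
qed

lemma ripple''_ge: "ripple'' m x \<ge> - (5/16) * 9 ^ m"
proof -
  define c where "c = cos (3 ^ m * x)"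
  have c: "- 1 \<le> c" unfolding c_def by (rule cos_ge_minus_one)
  \<comment> \<open>division by \<open>c + 1\<close>: the minimum on \<open>[-1, 1]\<close> is attained at \<open>c = -1\<close>\<close>
  have "2 * c ^ 3 - 2 * c\<^sup>2 - c / 2 + 1 = - 5/2 + (c + 1) * (2 * (c - 1)\<^sup>2 + 3/2)"
    by (simp add: power2_eq_square power3_eq_cube field_simps)
  moreover have "(c + 1) * (2 * (c - 1)\<^sup>2 + 3/2) \<ge> 0"
    using c by (intro mult_nonneg_nonneg) auto
  ultimately have "2 * c ^ 3 - 2 * c\<^sup>2 - c / 2 + 1 \<ge> - 5/2" by linarith
  from mult_left_mono[OF this, of "9 ^ m / 8"] show ?thesis
    unfolding ripple''_cubic c_def[symmetric] by simp
qed

text \<open>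
  Either \<open>cos(3\<^sup>m x) \<ge> -3/5\<close>, and then the ripple suffices, or \<open>-1/2 - cos(3\<^sup>m x) \<ge> 1/10\<close>, and then the
  \<open>m\<close>-th bump is bounded below and a large multiple of it outweighs the negative part.
\<close>

lemma bump_dominates_ripple:
  assumes "M * (flat 0 (1/10) / fact m) \<ge> 9 ^ m" "M \<ge> 0"
  shows "M * cantor_bump x + ripple'' m x \<ge> 9 ^ m / 80"
proof (cases "cos (3 ^ m * x) \<ge> - 3/5")
  case True
  then show ?thesis
    using ripple''_large[OF True] assms(2) cantor_bump_nonneg[of x] by (simp add: add_increasing)
next
  case False
  then have "flat 0 (1/10) / fact m \<le> flat 0 (- 1/2 - cos (3 ^ m * x)) / fact m"
    by (intro divide_right_mono flat_0_mono) auto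
  also have "\<dots> \<le> cantor_bump x" by (rule cantor_bump_ge)
  finally have "M * (flat 0 (1/10) / fact m) \<le> M * cantor_bump x"
    using assms(2) by (rule mult_left_mono)
  moreover have "(9::real) ^ m > 0" by simp
  ultimately show ?thesis using assms(1) ripple''_ge[of m x] by linarith
qed

context cantor_weight
begin

text \<open>
  On the boundary \<open>\<bar>w\<bar>\<^sup>2 exp(h) = 1 - \<kappa>\<close> with \<open>\<kappa> = k(x) + k(y)\<close>. With \<open>k \<le> k''\<close> the left hand side is at
  least \<open>(1 - \<kappa>) f + \<kappa>\<close>, a mean of \<open>f\<close> and 1, and \<open>f \<le> 1\<close>.
\<close>

lemma bdry_degeneracy_ge:
  assumes "rho z = 0"
  shows "(cmod (z 1))\<^sup>2 * exp (h (Re (z 0))) * cantor_bump (Re (z 0)) + cap'' (Re (z 0)) + cap'' (Im (z 0))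
    \<ge> cantor_bump (Re (z 0))"
proof -
  define \<kappa> where "\<kappa> = cap (Re (z 0)) + cap (Im (z 0))"
  define b where "b = cantor_bump (Re (z 0))"
  have e: "(cmod (z 1))\<^sup>2 * exp (h (Re (z 0))) = 1 - \<kappa>"
    using assms by (simp add: rho_eq \<kappa>_def)
  have "\<kappa> \<le> cap'' (Re (z 0)) + cap'' (Im (z 0))"
    unfolding \<kappa>_def using rho_le_0_bounds(1,2)[of z] assms by (intro add_mono cap_le_cap'') auto
  moreover have "\<kappa> * (1 - b) \<ge> 0"
    using cantor_bump_le_1 cap_nonneg by (intro mult_nonneg_nonneg) (auto simp: \<kappa>_def b_def)
  ultimately show ?thesis
    unfolding b_def[symmetric] e by (simp add: algebra_simps)
qed

text \<open>
  With \<open>\<zeta> = \<xi>\<^sub>1 + w h'/2 \<xi>\<^sub>0\<close> and \<open>\<kappa>\<close> a bound for \<open>\<bar>w h'/2\<bar>\<^sup>2\<close> one has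
  \<open>\<bar>\<xi>\<bar>\<^sup>2 \<le> 2 \<bar>\<zeta>\<bar>\<^sup>2 + (1 + 2 \<kappa>) \<bar>\<xi>\<^sub>0\<bar>\<^sup>2\<close>. The exponent \<open>m\<close> is chosen first, to dominate the
  coefficient of \<open>\<bar>\<xi>\<^sub>0\<bar>\<^sup>2\<close>, and then the multiple \<open>M\<close>, to dominate that of \<open>\<bar>\<zeta>\<bar>\<^sup>2\<close> and the negative part
  of the ripple.
\<close>

lemma property_P_Omega: "property_P 2 Omega"
  unfolding property_P_def
proof (intro allI impI)
  fix A :: real assume A: "A > 0"
  obtain \<mu> H where \<mu>: "\<mu> > 0" "\<And>x. x^2 < 66 \<Longrightarrow> exp (h x) \<ge> \<mu>" and H: "\<And>x. x^2 < 66 \<Longrightarrow> (h1 x)\<^sup>2 \<le> H"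
    using weight_bounds by metis
  define \<kappa> where "\<kappa> = H / (4 * \<mu>)"
  obtain m where "320 * (A * (1 + 2 * \<kappa>)) < 9 ^ m"
    using real_arch_pow[of 9] by auto
  then have m: "A * (1 + 2 * \<kappa>) \<le> 9 ^ m / 80 / 4" by simp
  define M where "M = max (2 * A / \<mu>) (9 ^ m / (flat 0 (1/10) / fact m))"
  have fl: "flat 0 (1/10) / fact m > 0" by (simp add: flat_pos)
  have M: "M * \<mu> \<ge> 2 * A" "M * (flat 0 (1/10) / fact m) \<ge> 9 ^ m"
    using fl \<mu>(1) by (simp_all only: M_def pos_divide_le_eq[symmetric] max.cobounded1 max.cobounded2)
  have M0: "M > 0" using A \<mu>(1) by (simp add: M_def less_max_iff_disj)
  define lam where "lam = hartogs (\<lambda>x. M * exp (h x)) (\<lambda>x. M * (cap x - 1) + ripple m x + 1/2) (\<lambda>y. M * cap y)"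
  have lam: "lam z = M * rho z + ripple m (Re (z 0)) + 1/2" for z
    by (simp add: lam_def rho_def hartogs_def algebra_simps)
  have lam_smooth: "lam \<in> csmooth"
    unfolding lam_def
  proof (rule hartogs_csmooth[OF smooth_exp_h])
    have "smooth (\<lambda>x. M * (cap x + (-1)) + ripple m x + 1/2)"
      by (intro smooth_intros smooth_cap smooth_ripple)
    then show "smooth (\<lambda>x. M * (cap x - 1) + ripple m x + 1/2)" by simp
    show "smooth (\<lambda>y. M * cap y)" by (intro smooth_intros smooth_cap)
  qed
  define U where "U = Cn 2 \<inter> rho -` {- 1 / (4 * M) <..< 1 / (4 * M)}"
  have "open_Cn 2 U"
    unfolding U_def open_Cn_def by (rule continuous_openin_preimage_gen[OF rho_continuous]) simp
  moreover have "bdry 2 Omega \<subseteq> U"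
    using M0 by (auto simp: bdry_Omega U_def)
  moreover have "C_k 2 2 U lam" by (rule csmooth_C_k[OF lam_smooth])
  moreover have "\<forall>z\<in>U. 0 \<le> lam z \<and> lam z \<le> 1"
  proof
    fix z assume "z \<in> U"
    then have "- (1/4) < M * rho z" "M * rho z < 1/4"
      using M0 by (auto simp: U_def field_simps)
    then show "0 \<le> lam z \<and> lam z \<le> 1"
      using abs_ripple[of m "Re (z 0)"] unfolding lam by linarith
  qed
  moreover have "Re (complex_hessian 2 lam z \<xi> \<xi>) \<ge> A * (cnorm 2 \<xi>)\<^sup>2" if z: "z \<in> bdry 2 Omega" for z \<xi>
  proof -
    define x where "x = Re (z 0)"
    define \<zeta> where "\<zeta> = \<xi> 1 + of_real (h1 x / 2) * z 1 * \<xi> 0"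
    have r: "rho z = 0" using z by (simp add: bdry_Omega)
    then have x: "x^2 < 66" and e: "(cmod (z 1))\<^sup>2 * exp (h x) \<le> 1"
      using rho_le_0_bounds(3,4)[of z] by (auto simp: x_def)
    have "(cmod (z 1))\<^sup>2 * \<mu> \<le> (cmod (z 1))\<^sup>2 * exp (h x)"
      using \<mu>(2)[OF x] by (intro mult_left_mono) auto
    then have "(cmod (z 1))\<^sup>2 \<le> 1 / \<mu>"
      using e \<mu>(1) by (simp add: field_simps)
    then have "(h1 x)\<^sup>2 / 4 * (cmod (z 1))\<^sup>2 \<le> H / 4 * (1 / \<mu>)"
      using H[OF x] order_trans[OF zero_le_power2 H[OF x]] by (intro mult_mono) auto
    then have k: "(h1 x)\<^sup>2 / 4 * (cmod (z 1))\<^sup>2 \<le> \<kappa>" by (simp add: \<kappa>_def)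
    have sq: "(a + b)\<^sup>2 \<le> 2 * a\<^sup>2 + 2 * b\<^sup>2" for a b :: real
      using zero_le_power2[of "a - b"] by (simp add: power2_eq_square algebra_simps)
    have "cmod (\<xi> 1) \<le> cmod \<zeta> + cmod (of_real (h1 x / 2) * z 1 * \<xi> 0)"
      unfolding \<zeta>_def by (metis add_diff_cancel_right' norm_triangle_ineq4)
    then have "(cmod (\<xi> 1))\<^sup>2 \<le> (cmod \<zeta> + cmod (of_real (h1 x / 2) * z 1 * \<xi> 0))\<^sup>2"
      by (intro power_mono) auto
    also have "\<dots> \<le> 2 * (cmod \<zeta>)\<^sup>2 + 2 * (cmod (of_real (h1 x / 2) * z 1 * \<xi> 0))\<^sup>2"
      by (rule sq)
    also have "(cmod (of_real (h1 x / 2) * z 1 * \<xi> 0))\<^sup>2 = (h1 x)\<^sup>2 / 4 * (cmod (z 1))\<^sup>2 * (cmod (\<xi> 0))\<^sup>2"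
      by (simp add: norm_mult power_mult_distrib power_divide)
    also have "\<dots> \<le> \<kappa> * (cmod (\<xi> 0))\<^sup>2" using k by (intro mult_right_mono) auto
    finally have "(cnorm 2 \<xi>)\<^sup>2 \<le> 2 * (cmod \<zeta>)\<^sup>2 + (1 + 2 * \<kappa>) * (cmod (\<xi> 0))\<^sup>2"
      by (simp add: cnorm_2 algebra_simps)
    from mult_left_mono[OF this, of A]
    have "A * (cnorm 2 \<xi>)\<^sup>2 \<le> 2 * A * (cmod \<zeta>)\<^sup>2 + A * (1 + 2 * \<kappa>) * (cmod (\<xi> 0))\<^sup>2"
      using A by (simp add: algebra_simps)
    also have "\<dots> \<le> M * exp (h x) * (cmod \<zeta>)\<^sup>2
        + (M * ((cmod (z 1))\<^sup>2 * exp (h x)) * cantor_bump x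
          + (M * cap'' x + ripple'' m x) + M * cap'' (Im (z 0))) / 4 * (cmod (\<xi> 0))\<^sup>2"
    proof (intro add_mono mult_right_mono)
      have "M * \<mu> \<le> M * exp (h x)" using M0 \<mu>(2)[OF x] by simp
      then show "2 * A \<le> M * exp (h x)" using M(1) by linarith
      have "M * cantor_bump x \<le> M * ((cmod (z 1))\<^sup>2 * exp (h x) * cantor_bump x + cap'' x + cap'' (Im (z 0)))"
        using bdry_degeneracy_ge[OF r] M0 unfolding x_def by (intro mult_left_mono) auto
      then have "9 ^ m / 80 \<le> M * ((cmod (z 1))\<^sup>2 * exp (h x)) * cantor_bump x
          + (M * cap'' x + ripple'' m x) + M * cap'' (Im (z 0))"
        using bump_dominates_ripple[OF M(2), of x] M0 by (simp add: algebra_simps)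
      from divide_right_mono[OF this, of 4] show "A * (1 + 2 * \<kappa>) \<le> (M * ((cmod (z 1))\<^sup>2 * exp (h x)) * cantor_bump x
          + (M * cap'' x + ripple'' m x) + M * cap'' (Im (z 0))) / 4"
        by (intro order_trans[OF m]) simp
    qed auto
    also have "\<dots> = Re (complex_hessian 2 lam z \<xi> \<xi>)"
    proof -
      have "((\<lambda>x. M * (cap x - 1) + ripple m x + 1/2) has_real_derivative M * cap' t + ripple' m t) (at t)"
        "((\<lambda>t. M * cap' t + ripple' m t) has_real_derivative M * cap'' t + ripple'' m t) (at t)"
        "((\<lambda>y. M * cap y) has_real_derivative M * cap' t) (at t)"
        "((\<lambda>t. M * cap' t) has_real_derivative M * cap'' t) (at t)" for t
        by (auto intro!: derivative_eq_intros cap_derivative cap'_derivative ripple_derivative ripple'_derivative)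
      from weighted_levi_form[OF this, of M z \<xi>] show ?thesis
        by (simp add: lam_def x_def \<zeta>_def)
    qed
    finally show ?thesis .
  qed
  ultimately show "\<exists>U lam. open_Cn 2 U \<and> bdry 2 Omega \<subseteq> U \<and> C_k 2 2 U lam \<and>
        (\<forall>z\<in>U. 0 \<le> lam z \<and> lam z \<le> 1) \<and>
        (\<forall>z\<in>bdry 2 Omega. \<forall>\<xi>\<in>Cn 2. Re (complex_hessian 2 lam z \<xi> \<xi>) \<ge> A * (cnorm 2 \<xi>)\<^sup>2)"
    by blast
qed

end

section \<open>The Levi core\<close>

lemma derivative_zero_at_limit_of_zeros:
  fixes g :: "real \<Rightarrow> real"
  assumes "(g has_real_derivative D) (at x)" "x islimpt S" "\<And>y. y \<in> S \<Longrightarrow> g y = 0" "x \<in> S"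
  shows "D = 0"
proof (rule tendsto_unique)
  show "at x within S \<noteq> bot" using assms(2) by (simp add: trivial_limit_within)
  show "((\<lambda>y. (g y - g x) / (y - x)) \<longlongrightarrow> D) (at x within S)"
    using assms(1) has_field_derivative_at_within[of g D x S] by (simp add: has_field_derivative_iff)
  show "((\<lambda>y. (g y - g x) / (y - x)) \<longlongrightarrow> 0) (at x within S)"
    by (rule tendsto_eventually) (use assms(3,4) in \<open>simp add: eventually_at_filter\<close>)
qed

text \<open>
  No information on the length of the iteration is needed to bound the core from below: a
  distribution that survives each derivation of a larger one also survives all limits.
\<close>

lemma subset_iter_distr:
  assumes "D0 \<subseteq> D" "\<And>E. D0 \<subseteq> E \<Longrightarrow> D0 \<subseteq> derived_distr n M E"
  shows "D0 \<subseteq> iter_distr n M D \<alpha>"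
proof (induction \<alpha> rule: wo_rel.well_order_induct[OF omega1_wo_rel])
  case (1 \<alpha>)
  then have IH: "D0 \<subseteq> iter_distr n M D \<beta>" if "\<beta> \<in> underS omega1 \<alpha>" for \<beta>
    using that by (auto simp: underS_def)
  consider "underS omega1 \<alpha> = {}" | \<beta> where "is_succ_of \<alpha> \<beta>"
    | "underS omega1 \<alpha> \<noteq> {}" "\<nexists>\<beta>. is_succ_of \<alpha> \<beta>" by blast
  then show ?case
  proof cases
    case 1
    then show ?thesis using assms(1) by (simp add: iter_distr_zero)
  next
    case (2 \<beta>)
    then have "\<beta> \<in> underS omega1 \<alpha>" by (simp add: is_succ_of_def)
    then show ?thesis unfolding iter_distr_succ[OF 2] by (intro assms(2) IH)
  next
    case 3
    then show ?thesis using IH unfolding iter_distr_limit[OF 3] by blast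
  qed
qed

lemma subset_core:
  assumes "D0 \<subseteq> D" "\<And>E. D0 \<subseteq> E \<Longrightarrow> D0 \<subseteq> derived_distr n M E"
  shows "D0 \<subseteq> core n M D"
  unfolding core_def by (rule subset_iter_distr[OF assms])

context cantor_weight
begin

definition core_points :: "cvec set" where
  "core_points = {z \<in> Cn 2. Re (z 0) \<in> cantor \<and> \<bar>Im (z 0)\<bar> < 1 \<and> (cmod (z 1))\<^sup>2 * exp (h (Re (z 0))) = 1}"

definition null_vector :: "cvec \<Rightarrow> complex \<Rightarrow> cvec" where
  "null_vector p a = (\<lambda>j. if j = 0 then a else if j = 1 then - (of_real (h1 (Re (p 0)) / 2) * p 1 * a) else 0)"

definition core_distr :: "ctangent set" where
  "core_distr = {(p, holo_vector (null_vector p a)) | p a. p \<in> core_points}"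

lemma core_points_bdry: "core_points \<subseteq> bdry 2 Omega"
proof
  fix z assume z: "z \<in> core_points"
  then have "0 \<le> Re (z 0)" "Re (z 0) \<le> 2 * pi" by (auto simp: core_points_def cantor_def)
  then have "cap (Re (z 0)) = 0" "cap (Im (z 0)) = 0"
    using z pi_less_4 by (auto simp: core_points_def intro!: cap_zero)
  then show "z \<in> bdry 2 Omega" using z by (simp add: bdry_Omega core_points_def rho_eq)
qed

lemma null_vector_Cn: "null_vector p a \<in> Cn 2"
  by (auto simp: null_vector_def Cn_def)

lemma holo_vector_null_vector:
  "holo_vector (null_vector p a) = (null_vector p (a / 2), null_vector p (- \<i> * a / 2))"
  by (auto simp: holo_vector_def null_vector_def fun_eq_iff)

text \<open>
  The modulus of the second coordinate keeps \<open>\<bar>w\<bar>\<^sup>2 exp(h)\<close> constant, and its argument turns with \<open>y\<close> at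
  the rate for which the sheet is tangent at \<open>p\<close> to the complex null direction.
\<close>

definition sheet :: "cvec \<Rightarrow> real \<Rightarrow> real \<Rightarrow> cvec" where
  "sheet p x y = (\<lambda>j. if j = 0 then Complex x y
     else if j = 1 then p 1 * exp (Complex (- (h x - h (Re (p 0))) / 2) (- (y - Im (p 0)) * h1 (Re (p 0)) / 2))
     else 0)"

lemma sheet_core_points:
  assumes "p \<in> core_points" "x \<in> cantor" "\<bar>y\<bar> < 1"
  shows "sheet p x y \<in> core_points"
proof -
  have sq: "(exp (t / 2))\<^sup>2 = exp t" for t :: real
    by (simp flip: exp_double)
  have "(cmod (p 1) * exp (- (h x - h (Re (p 0))) / 2))\<^sup>2 * exp (h x)
      = (cmod (p 1))\<^sup>2 * exp (- (h x - h (Re (p 0))) + h x)"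
    by (simp only: power_mult_distrib sq mult.assoc exp_add)
  also have "\<dots> = 1" using assms(1) by (simp add: core_points_def)
  finally show ?thesis
    using assms by (simp add: core_points_def sheet_def Cn_def norm_mult)
qed

lemma sheet_self: "p \<in> Cn 2 \<Longrightarrow> sheet p (Re (p 0)) (Im (p 0)) = p"
  by (auto simp: sheet_def fun_eq_iff Cn_def complex_eq_iff simp flip: zero_complex.code)

lemma sheet_Cn: "sheet p x y \<in> Cn 2"
  by (auto simp: sheet_def Cn_def)

text \<open>
  The sheet through \<open>p\<close> has partial derivatives \<open>(1, \<kappa>)\<close> and \<open>(\<i>, \<kappa> \<i>)\<close> at \<open>p\<close>, where \<open>\<kappa> = - w h'/2\<close>, and
  these span the null direction over \<open>\<real>\<close>. The function \<open>f\<close> vanishes on the whole line in the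
  direction \<open>y\<close>, and in the direction \<open>x\<close> on a set that accumulates at \<open>p\<close>.
\<close>

lemma dir_deriv_null_vector:
  assumes f: "smooth_near 2 M f" "\<And>z. z \<in> core_points \<Longrightarrow> f z = 0"
    and p: "p \<in> core_points" "core_points \<subseteq> M"
  shows "dir_deriv f p (null_vector p a) = 0"
proof -
  obtain U where U: "open_Cn 2 U" "M \<subseteq> U" "C_infinity 2 U f"
    using f(1) unfolding smooth_near_def by blast
  have C1: "C_k 2 1 U f" using U(3) unfolding C_infinity_def by blast
  have pU: "p \<in> U" using U(2) p by blast
  note curve = C1_curve[OF U(1) C1 pU]
  define x0 where "x0 = Re (p 0)"
  define y0 where "y0 = Im (p 0)"
  define \<kappa> where "\<kappa> = - (of_real (h1 x0 / 2) * p 1)"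
  have p2: "p \<in> Cn 2" and x0: "x0 \<in> cantor" and y0: "\<bar>y0\<bar> < 1"
    using p by (auto simp: core_points_def x0_def y0_def)
  have ex: "exp (Complex t 0) = of_real (exp t)" and ey: "exp (Complex 0 t) = of_real (cos t) + \<i> * of_real (sin t)" for t
    by (simp_all add: exp_eq_polar complex_eq_iff)
  note self = sheet_self[OF p2, folded x0_def y0_def]
  have "((\<lambda>s. f (sheet p (x0 + s) y0)) has_real_derivative differential f p 1 \<kappa>) (at 0)"
  proof (rule curve)
    have "((\<lambda>s. of_real (x0 + s) + \<i> * of_real y0) has_vector_derivative 1) (at 0)"
      by (auto intro!: derivative_eq_intros)
    then show "((\<lambda>s. sheet p (x0 + s) y0 0) has_vector_derivative 1) (at 0)"
      by (simp add: sheet_def Complex_eq)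
    have "((\<lambda>s. h (x0 + s)) has_real_derivative h1 x0) (at 0)"
      using h(2)[of x0] DERIV_shift[of h "h1 x0" 0 x0] by (simp add: add.commute)
    then have "((\<lambda>s. p 1 * of_real (exp (- (h (x0 + s) - h x0) / 2))) has_vector_derivative \<kappa>) (at 0)"
      unfolding \<kappa>_def by (auto intro!: derivative_eq_intros)
    moreover have "sheet p (x0 + s) y0 1 = p 1 * of_real (exp (- (h (x0 + s) - h x0) / 2))" for s
      by (simp add: sheet_def x0_def y0_def ex)
    ultimately show "((\<lambda>s. sheet p (x0 + s) y0 1) has_vector_derivative \<kappa>) (at 0)" by simp
  qed (use self sheet_Cn in auto)
  then have "((\<lambda>x. f (sheet p x y0)) has_real_derivative differential f p 1 \<kappa>) (at x0)"
    using DERIV_shift[of "\<lambda>x. f (sheet p x y0)" "differential f p 1 \<kappa>" 0 x0] by (simp add: add.commute)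
  then have dx: "differential f p 1 \<kappa> = 0"
    by (rule derivative_zero_at_limit_of_zeros[OF _ cantor_perfect[OF x0] _ x0])
      (rule f(2)[OF sheet_core_points[OF p(1) _ y0]])
  have "((\<lambda>s. f (sheet p x0 (y0 + s))) has_real_derivative differential f p \<i> (\<kappa> * \<i>)) (at 0)"
  proof (rule curve)
    have "((\<lambda>s. of_real x0 + \<i> * of_real (y0 + s)) has_vector_derivative \<i>) (at 0)"
      by (auto intro!: derivative_eq_intros)
    then show "((\<lambda>s. sheet p x0 (y0 + s) 0) has_vector_derivative \<i>) (at 0)"
      by (simp add: sheet_def Complex_eq)
    have "((\<lambda>s. p 1 * (of_real (cos (- s * h1 x0 / 2)) + \<i> * of_real (sin (- s * h1 x0 / 2))))
        has_vector_derivative \<kappa> * \<i>) (at 0)"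
      unfolding \<kappa>_def by (auto intro!: derivative_eq_intros)
    moreover have "sheet p x0 (y0 + s) 1
        = p 1 * (of_real (cos (- s * h1 x0 / 2)) + \<i> * of_real (sin (- s * h1 x0 / 2)))" for s
      by (simp add: sheet_def x0_def y0_def ey)
    ultimately show "((\<lambda>s. sheet p x0 (y0 + s) 1) has_vector_derivative \<kappa> * \<i>) (at 0)" by simp
  qed (use self sheet_Cn in auto)
  then have "((\<lambda>y. f (sheet p x0 y)) has_real_derivative differential f p \<i> (\<kappa> * \<i>)) (at y0)"
    using DERIV_shift[of "\<lambda>y. f (sheet p x0 y)" "differential f p \<i> (\<kappa> * \<i>)" 0 y0] by (simp add: add.commute)
  moreover have y: "y0 \<in> {-1<..<1}" using y0 by auto
  moreover have "y0 islimpt {-1<..<1}"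
    using y by (intro interior_limit_point) simp
  moreover have "f (sheet p x0 y) = 0" if "y \<in> {-1<..<1}" for y
    using that by (intro f(2) sheet_core_points p x0) auto
  ultimately have dy: "differential f p \<i> (\<kappa> * \<i>) = 0"
    by (metis derivative_zero_at_limit_of_zeros)
  have "((\<lambda>t. f (shift p (null_vector p a) t)) has_real_derivative differential f p a (\<kappa> * a)) (at 0)"
    by (rule curve)
      (auto simp: shift_def null_vector_def \<kappa>_def x0_def intro!: derivative_eq_intros
        shift_in_Cn[unfolded shift_def] p2 null_vector_Cn[unfolded null_vector_def])
  then have "dir_deriv f p (null_vector p a) = differential f p a (\<kappa> * a)"
    unfolding dir_deriv_def has_real_derivative_iff_has_vector_derivative by (rule vector_derivative_at)
  also have "\<dots> = Re a * differential f p 1 \<kappa> + Im a * differential f p \<i> (\<kappa> * \<i>)"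
    by (simp add: differential_def algebra_simps)
  finally show ?thesis using dx dy by simp
qed

text \<open>
  Vanishing on a superset of \<open>core_points\<close> is a stronger condition than vanishing on \<open>core_points\<close>,
  so the previous lemma applies to every intermediate support \<open>S\<close>, and to the whole boundary.
\<close>

lemma core_distr_tangent:
  assumes "(p, X) \<in> core_distr" "core_points \<subseteq> S" "S \<subseteq> bdry 2 Omega"
  shows "(p, X) \<in> complexify (tangent_of_subset 2 (bdry 2 Omega) S)"
proof -
  obtain a where p: "p \<in> core_points" and X: "X = holo_vector (null_vector p a)"
    using assms(1) by (auto simp: core_distr_def)
  have "(p, null_vector p b) \<in> tangent_of_subset 2 (bdry 2 Omega) S" for b
    unfolding tangent_of_subset_def tangent_bundle_def
    using p assms(2,3) core_points_bdry
    by (auto intro!: null_vector_Cn dir_deriv_null_vector)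
  then show ?thesis by (simp add: complexify_def X holo_vector_null_vector)
qed

lemma core_distr_subset_levi_null: "core_distr \<subseteq> levi_null 2 Omega"
proof
  fix q assume "q \<in> core_distr"
  then obtain p a where q: "q = (p, holo_vector (null_vector p a))" and p: "p \<in> core_points"
    by (auto simp: core_distr_def)
  have "(p, holo_vector (null_vector p a)) \<in> complexify (tangent_of_subset 2 (bdry 2 Omega) core_points)"
    by (rule core_distr_tangent) (use core_points_bdry p in \<open>auto simp: core_distr_def\<close>)
  then have "null_vector p a \<in> T10 2 (bdry 2 Omega) p"
    by (auto simp: T10_def null_vector_Cn complexify_def tangent_of_subset_def)
  moreover have "complex_hessian 2 rho p (null_vector p a) \<eta> = 0" for \<eta>
  proof -
    have z: "p \<in> bdry 2 Omega" using p core_points_bdry by blast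
    have "\<bar>Re (p 0)\<bar> \<le> 8" "\<bar>Im (p 0)\<bar> \<le> 8"
      using p pi_less_4 by (auto simp: core_points_def cantor_def)
    then have "(Re (p 0))\<^sup>2 \<le> 64" "(Im (p 0))\<^sup>2 \<le> 64"
      using abs_le_square_iff[of "Re (p 0)" 8] abs_le_square_iff[of "Im (p 0)" 8] by auto
    then have "cap'' (Re (p 0)) = 0" "cap'' (Im (p 0)) = 0"
      by (simp_all add: cap''_def flat_nonpos_arg)
    moreover have "cantor_bump (Re (p 0)) = 0"
      using p by (simp add: core_points_def cantor_bump_cantor)
    ultimately show ?thesis
      unfolding rho_hartogs weighted_hessian[OF rho_derivs] by (simp add: null_vector_def)
  qed
  ultimately show "q \<in> levi_null 2 Omega"
    using p core_points_bdry defining_function_rho unfolding q levi_null_def by blast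
qed

lemma core_points_nonempty: "core_points \<noteq> {}"
proof -
  have "(\<lambda>j. if j = 1 then of_real (exp (- h 0 / 2)) else 0) \<in> core_points"
    using zero_in_cantor by (simp add: core_points_def Cn_def flip: exp_double exp_add)
  then show ?thesis by blast
qed

lemma core_points_subset_dsupport:
  assumes "core_distr \<subseteq> E"
  shows "core_points \<subseteq> dsupport (bdry 2 Omega) E"
proof
  fix p assume p: "p \<in> core_points"
  then have "(p, holo_vector (null_vector p 2)) \<in> E" using assms by (auto simp: core_distr_def)
  moreover have "holo_vector (null_vector p 2) \<noteq> (\<lambda>_. 0, \<lambda>_. 0)"
    by (auto simp: holo_vector_def null_vector_def fun_eq_iff)
  ultimately show "p \<in> dsupport (bdry 2 Omega) E"
    using p core_points_bdry by (auto simp: dsupport_def fiber_def)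
qed

lemma nontrivial_levi_core_Omega: "nontrivial_levi_core 2 Omega"
proof -
  have "core_distr \<subseteq> levi_core 2 Omega"
    unfolding levi_core_def
  proof (rule subset_core[OF core_distr_subset_levi_null])
    fix E assume E: "core_distr \<subseteq> E"
    show "core_distr \<subseteq> derived_distr 2 (bdry 2 Omega) E"
    proof
      fix q assume q: "q \<in> core_distr"
      then have "q \<in> complexify (tangent_of_subset 2 (bdry 2 Omega) (dsupport (bdry 2 Omega) E))"
        using core_distr_tangent[of "fst q" "snd q"] core_points_subset_dsupport[OF E]
        by (simp add: dsupport_def)
      then show "q \<in> derived_distr 2 (bdry 2 Omega) E"
        using q E by (auto simp: derived_distr_def)
    qed
  qed
  then show ?thesis
    using core_points_subset_dsupport core_points_nonempty unfolding nontrivial_levi_core_def by blast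
qed

end

theorem mainTheorem4:
  shows "\<exists>(n::nat) (\<Omega>::cvec set). n \<ge> 2 \<and> bounded_domain n \<Omega> \<and> smooth_boundary n \<Omega> \<and>
    pseudoconvex n \<Omega> \<and> property_P n \<Omega> \<and> nontrivial_levi_core n \<Omega>"
proof -
  obtain h1 where h1: "smooth h1" "\<And>x. (h1 has_real_derivative cantor_bump x) (at x)"
    using smooth_antiderivative[OF cantor_bump_series(2)] by blast
  obtain h where h: "smooth h" "\<And>x. (h has_real_derivative h1 x) (at x)"
    using smooth_antiderivative[OF h1(1)] by blast
  interpret cantor_weight h h1
    by unfold_locales (fact h h1)+
  have "smooth_boundary 2 Omega"
    using defining_function_rho unfolding smooth_boundary_def by blast
  then show ?thesis
    using bounded_domain_Omega pseudoconvex_Omega property_P_Omega nontrivial_levi_core_Omega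
    by (intro exI[of _ 2] exI[of _ Omega]) simp
qed

end
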